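(* Let $d\ge2$ and let $G=(V,E)$ be a finite graph. Let $f':2^E\to\mathbb{Z}$ be $f'(F)=d|V(F)|-(d+1)$. Then, for almost all joint-configurations $\mathbf{p}:V\to\mathbb{R}^d$, the linear polymatroid $\mathcal{PM}(\mathcal{A}(\mathbf{p}))$ equals the polymatroid $(E,\hat{f'})$; that is, $\mathrm{rank}(\overline{\mathcal{A}_F(\mathbf{p})})=\hat{f'}(F)$ for every $F\subseteq E$.
   Context: $V(F)$ is the set of vertices incident to edges of $F$. $\hat{f'}(F)=\min\sum_{i=1}^kf'(F_i)$ over partitions $\{F_1,\dots,F_k\}$ of $F$ into nonempty subsets, with $\hat{f'}(\emptyset)=0$. Let $V_v=\mathbb{R}^d$ for each $v\in V$ and $V_V=\prod_{v\in V}V_v$. For $uv\in E$, $A_{uv}(\mathbf{p})$ is the flat of $\mathbb{P}(V_V)$ consisting of points whose $u$-block is $\boldsymbol\alpha$, $v$-block is $-\boldsymbol\alpha$ and other blocks are $0$, where $\boldsymbol\alpha\in\mathbb{R}^d$ ranges over nonzero vectors with $(\mathbf{p}(u)-\mathbf{p}(v))\cdot\boldsymbol\alpha=0$. $\mathcal{A}_F(\mathbf{p})=\{A_e(\mathbf{p}):e\in F\}$, $\mathcal{A}(\mathbf{p})=\mathcal{A}_E(\mathbf{p})$; $\overline{\cdot}$ is the projective span and the rank of a flat is the dimension of its associated linear subspace; $\mathcal{PM}(\mathcal{A}(\mathbf{p}))$ is the polymatroid on $E$ with rank function $F\mapsto\mathrm{rank}(\overline{\mathcal{A}_F(\mathbf{p})})$.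 *)

theory Defs
  imports "HOL-Analysis.Analysis" "HOL-Library.Disjoint_Sets"
begin

section \<open>Projective space over a Euclidean space\<close>

text \<open>Points of the projective space over \<^typ>\<open>'a\<close> are the one-dimensional linear
  subspaces. \<open>proj_flat W\<close> is the flat associated with a linear subspace \<open>W\<close>.\<close>

definition proj_flat :: "'a::euclidean_space set \<Rightarrow> 'a set set" where
  "proj_flat W = {span {x} | x. x \<in> W \<and> x \<noteq> 0}"

definition proj_span :: "'a::euclidean_space set set \<Rightarrow> 'a set set" where
  "proj_span S = \<Inter>{proj_flat W | W. subspace W \<and> S \<subseteq> proj_flat W}"

text \<open>The linear subspace associated with a flat; \<open>0\<close> is inserted explicitly because of
  the empty flat.\<close>

definition flat_subspace :: "'a::euclidean_space set set \<Rightarrow> 'a set" where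
  "flat_subspace L = insert 0 (\<Union>L)"

definition flat_rank :: "'a::euclidean_space set set \<Rightarrow> nat" where
  "flat_rank L = dim (flat_subspace L)"


section \<open>Graphs\<close>

text \<open>A graph has vertex set \<^term>\<open>UNIV :: 'v::finite set\<close>, an edge set \<open>E\<close> and an endpoint map
  \<open>ends\<close>. Parallel edges are allowed, loops are not (the flat of a loop would make no
  sense); a simple graph is the case where the edges are two-element vertex sets and
  \<open>ends\<close> is the identity.\<close>

definition finite_graph :: "'e set \<Rightarrow> ('e \<Rightarrow> 'v::finite set) \<Rightarrow> bool" where
  "finite_graph E ends \<longleftrightarrow> finite E \<and> (\<forall>e\<in>E. card (ends e) = 2)"

definition edge_verts :: "('e \<Rightarrow> 'v set) \<Rightarrow> 'e set \<Rightarrow> 'v set" where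
  "edge_verts ends F = \<Union>(ends ` F)"


section \<open>The flats of a joint-configuration\<close>

text \<open>The block space, the product of one copy of \<open>d\<close>-space for each vertex, is
  \<^typ>\<open>real^'d^'v\<close>; a joint-configuration \<open>p\<close> has the same type, \<open>p $ v\<close> being the
  position of \<open>v\<close>.\<close>

definition edge_vec :: "'v::finite \<Rightarrow> 'v \<Rightarrow> real^'d \<Rightarrow> real^'d^'v" where
  "edge_vec u v \<alpha> = (\<chi> w. if w = u then \<alpha> else if w = v then - \<alpha> else 0)"

text \<open>The two orderings of the endpoints contribute the same points, as \<open>\<alpha>\<close> may be
  replaced by \<open>- \<alpha>\<close>.\<close>

definition edge_flat ::
  "('e \<Rightarrow> 'v::finite set) \<Rightarrow> real^'d^'v \<Rightarrow> 'e \<Rightarrow> (real^'d^'v) set set" where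
  "edge_flat ends p e =
     {span {edge_vec u v \<alpha>} | u v \<alpha>.
        ends e = {u, v} \<and> u \<noteq> v \<and> \<alpha> \<noteq> 0 \<and> (p $ u - p $ v) \<bullet> \<alpha> = 0}"

definition edge_flats ::
  "('e \<Rightarrow> 'v::finite set) \<Rightarrow> real^'d^'v \<Rightarrow> 'e set \<Rightarrow> (real^'d^'v) set set set" where
  "edge_flats ends p F = edge_flat ends p ` F"

text \<open>The rank function of the linear polymatroid of the flats.\<close>

definition PM_rank :: "('e \<Rightarrow> 'v::finite set) \<Rightarrow> real^'d^'v \<Rightarrow> 'e set \<Rightarrow> nat" where
  "PM_rank ends p F = flat_rank (proj_span (\<Union>(edge_flats ends p F)))"


section \<open>The combinatorial rank function\<close>

definition count_fun :: "nat \<Rightarrow> ('e \<Rightarrow> 'v set) \<Rightarrow> 'e set \<Rightarrow> int" where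
  "count_fun d ends F = int d * int (card (edge_verts ends F)) - (int d + 1)"

definition hat :: "('e set \<Rightarrow> int) \<Rightarrow> 'e set \<Rightarrow> int" where
  "hat f F = (if F = {} then 0 else Min {\<Sum>X\<in>P. f X | P. partition_on F P})"

end

theory Submission
  imports Defs
begin

text \<open>The flat of an edge \<open>uv\<close> is the intersection of the flat of all \<open>\<alpha>\<close> at \<open>u\<close>, \<open>- \<alpha>\<close> at \<open>v\<close>
  with the hyperplane orthogonal to \<open>p\<close>, so the claim is an instance of Lovasz's theorem: for a
  generic hyperplane, the slices of subspaces \<open>A e\<close> have as rank function the Dilworth truncation
  of \<open>X \<mapsto> dim (\<Union>e\<in>X. A e) - 1\<close>. The upper bound is a count over any partition. For the lower
  bound, let \<open>W\<close> be the span of the slices. Modulo \<open>W\<close> each \<open>A e\<close> is a line; group the edges by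
  these lines. A vector \<open>m\<close> orthogonal to \<open>W\<close> is a multiple \<open>c\<^sub>X p\<close> of \<open>p\<close> on the span of each
  group \<open>X\<close>. Since the rank is generically constant, a dependency \<open>\<Sum>w\<^sub>X = 0\<close> between the slices
  of the groups extends to nearby hyperplanes, and differentiating it and pairing with \<open>m\<close> gives the
  dependency \<open>\<Sum>c\<^sub>X w\<^sub>X = 0\<close>. As the groups can be separated by suitable \<open>m\<close>, all \<open>w\<^sub>X\<close> vanish,
  so that the slices of the groups form a direct sum.\<close>

section \<open>Semicontinuity of the dimension\<close>

text \<open>Linear independence survives small perturbations: a basis of \<open>span B\<close> taken
  from \<open>B\<close> is carried to nearby vectors of \<open>V x\<close> by a linear map close to
  the identity, hence injective. The filter is arbitrary, so that full neighbourhoods and punctured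
  ones are both covered.\<close>

lemma dim_lower_semicontinuous:
  fixes B :: "'a::euclidean_space set"
  assumes "\<And>b. b \<in> B \<Longrightarrow> \<exists>h. (h \<longlongrightarrow> b) F \<and> (\<forall>\<^sub>F x in F. h x \<in> V x)"
  shows "\<forall>\<^sub>F x in F. dim B \<le> dim (V x)"
proof -
  obtain C where C: "C \<subseteq> B" "independent C" "B \<subseteq> span C" "card C = dim B"
    by (rule basis_exists)
  have fin: "finite C"
    using C(2) by (rule independent_imp_finite)
  have "\<forall>b\<in>C. \<exists>h. (h \<longlongrightarrow> b) F \<and> (\<forall>\<^sub>F x in F. h x \<in> V x)"
    using assms C(1) by blast
  then obtain h where h: "\<And>b. b \<in> C \<Longrightarrow> (h b \<longlongrightarrow> b) F"
    "\<And>b. b \<in> C \<Longrightarrow> \<forall>\<^sub>F x in F. h b x \<in> V x"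
    by metis
  \<comment> \<open>The \<open>g b\<close> are the coordinate functionals of the basis
    \<open>C\<close>, extended linearly to the whole space.\<close>
  have "\<exists>g. linear g \<and> (\<forall>c\<in>C. g c = (if c = b then 1 else (0::real)))" for b
    using linear_independent_extend[OF C(2)] .
  then obtain g :: "'a \<Rightarrow> 'a \<Rightarrow> real" where g: "\<And>b. linear (g b)"
    "\<And>b c. c \<in> C \<Longrightarrow> g b c = (if c = b then 1 else 0)"
    by metis
  have "\<exists>K. \<forall>v. norm (g b v) \<le> K * norm v" for b
    using linear_bounded[OF g(1)] .
  then obtain K where K: "\<And>b v. norm (g b v) \<le> K b * norm v"
    by metis
  \<comment> \<open>\<open>T x\<close> moves each basis vector \<open>c\<close> to
    \<open>h c x\<close>. Its distance from the identity is at most the sum of the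
    \<open>K b * norm (h b x - b)\<close>, which tends to 0; once this is below 1, a nonzero kernel
    vector would be strictly shorter than itself.\<close>
  define T where "T x v = v + (\<Sum>b\<in>C. g b v *\<^sub>R (h b x - b))" for x v
  have linT: "linear (T x)" for x
    by (rule linearI)
      (simp_all add: T_def linear_add[OF g(1)] linear_scale[OF g(1)] scaleR_add_left sum.distrib
        scaleR_add_right scaleR_sum_right)
  have T_basis: "T x c = h c x" if "c \<in> C" for x c
    using that fin by (simp add: T_def g(2) if_distrib[of "\<lambda>t. t *\<^sub>R _"] cong: if_cong)
  have "((\<lambda>x. \<Sum>b\<in>C. K b * norm (h b x - b)) \<longlongrightarrow> (\<Sum>b\<in>C. K b * norm (b - b))) F"
    by (intro tendsto_intros h(1))
  then have "\<forall>\<^sub>F x in F. (\<Sum>b\<in>C. K b * norm (h b x - b)) < 1"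
    by (rule order_tendstoD) simp
  moreover have "\<forall>\<^sub>F x in F. \<forall>b\<in>C. h b x \<in> V x"
    using h(2) fin by (simp add: eventually_ball_finite)
  ultimately show ?thesis
  proof eventually_elim
    fix x assume small: "(\<Sum>b\<in>C. K b * norm (h b x - b)) < 1" and mem: "\<forall>b\<in>C. h b x \<in> V x"
    have "v = 0" if "T x v = 0" for v
    proof (rule ccontr)
      assume "v \<noteq> 0"
      have "v = - (\<Sum>b\<in>C. g b v *\<^sub>R (h b x - b))"
        using that unfolding T_def eq_neg_iff_add_eq_0 .
      then have "norm v = norm (\<Sum>b\<in>C. g b v *\<^sub>R (h b x - b))"
        using norm_minus_cancel[of "\<Sum>b\<in>C. g b v *\<^sub>R (h b x - b)"] by (rule ssubst)
      also have "\<dots> \<le> (\<Sum>b\<in>C. norm (g b v *\<^sub>R (h b x - b)))"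
        by (rule norm_sum)
      also have "\<dots> \<le> (\<Sum>b\<in>C. (K b * norm v) * norm (h b x - b))"
        using K by (intro sum_mono) (simp add: mult_right_mono)
      also have "\<dots> = (\<Sum>b\<in>C. K b * norm (h b x - b)) * norm v"
        by (simp add: sum_distrib_left mult_ac)
      also have "\<dots> < 1 * norm v"
        using small \<open>v \<noteq> 0\<close> by (intro mult_strict_right_mono) auto
      finally show False by simp
    qed
    then have inj: "inj (T x)"
      using linear_injective_0[OF linT] by blast
    have "dim B = dim C"
      using C dim_eq_card_independent by metis
    also have "\<dots> = dim (T x ` C)"
      using dim_image_eq[OF linT] inj by (metis inj_on_subset subset_UNIV)
    also have "\<dots> \<le> dim (V x)"
      using mem T_basis by (intro dim_subset) auto
    finally show "dim B \<le> dim (V x)" .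
  qed
qed

text \<open>If the points of a bounded set avoid an open set that contains all nearby points of the
  parallels to \<open>q\<close> through them, then its translates by small rational multiples of \<open>q\<close>
  are pairwise disjoint.\<close>

lemma AE_line_puncture:
  fixes q :: "'a::euclidean_space"
  assumes "open U"
  shows "AE p in lborel. (\<forall>\<^sub>F s in at 0. p + s *\<^sub>R q \<in> U) \<longrightarrow> p \<in> U"
proof -
  \<comment> \<open>\<open>N n k\<close> collects the bad points of norm at most \<open>k\<close>
    whose punctured neighbourhood on the line has radius at least \<open>1 / Suc n\<close>. Only
    rational \<open>s\<close> are used, which keeps the intersection countable and the set
    Borel.\<close>
  define N where "N n k = {p \<in> cball 0 (real k). p \<notin> U} \<inter>
    (\<Inter>s\<in>{s \<in> \<rat>. s \<noteq> 0 \<and> \<bar>s\<bar> < 1 / real (Suc n)}. {p. p + s *\<^sub>R q \<in> U})" for n k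
  have N_sets: "N n k \<in> sets borel" for n k
  proof -
    have "open ((\<lambda>p. p + s *\<^sub>R q) -` U)" for s
      by (rule open_vimage[OF assms]) (intro continuous_intros)
    then have "{p. p + s *\<^sub>R q \<in> U} \<in> sets borel" for s
      by (simp add: vimage_def)
    moreover have "countable {s \<in> \<rat>. s \<noteq> 0 \<and> \<bar>s\<bar> < 1 / real (Suc n)}"
      using countable_rat by (rule countable_subset[rotated]) auto
    moreover have "(1 / (2 * real (Suc n))) \<in> {s \<in> \<rat>. s \<noteq> 0 \<and> \<bar>s\<bar> < 1 / real (Suc n)}"
      by (auto simp: divide_simps)
    then have "{s \<in> \<rat>. s \<noteq> 0 \<and> \<bar>s\<bar> < 1 / real (Suc n)} \<noteq> {}"
      by blast
    moreover have "{p \<in> cball 0 (real k). p \<notin> U} = cball 0 (real k) - U"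
      by auto
    ultimately show ?thesis
      unfolding N_def using assms
      by (intro sets.Int sets.countable_INT') (simp_all add: borel_open sets.Diff image_subset_iff)
  qed
  have N_null: "N n k \<in> null_sets lborel" for n k
  proof -
    \<comment> \<open>Distinct rationals strictly between 0 and \<open>1 / Suc n\<close>; the double
      \<open>Suc\<close> gives strictness already for \<open>i = 0\<close>. Differences of two of
      them are nonzero and again smaller than \<open>1 / Suc n\<close>, so a common point of two
      translates would put a point of \<open>N n k\<close> into \<open>U\<close>.\<close>
    define s where "s i = inverse (real (Suc (Suc (n + i))))" for i
    define A where "A i = (+) (s i *\<^sub>R q) ` N n k" for i
    have s_bound: "0 < s i" "s i < 1 / real (Suc n)" for i
      by (auto simp: s_def field_simps)
    have bounded: "bounded (N n k)"
      by (rule bounded_subset[of "cball 0 (real k)"]) (auto simp: N_def)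
    have meas: "N n k \<in> lmeasurable"
      using bounded N_sets by (intro bounded_set_imp_lmeasurable) auto
    have A_meas: "A i \<in> lmeasurable" for i
      unfolding A_def by (rule measurable_translation[OF meas])
    have "disjoint_family A"
      unfolding disjoint_family_on_def
    proof (intro ballI impI)
      fix i j :: nat assume "i \<noteq> j"
      show "A i \<inter> A j = {}"
      proof (rule ccontr)
        assume "A i \<inter> A j \<noteq> {}"
        then obtain x y where xy: "x \<in> N n k" "y \<in> N n k" "s i *\<^sub>R q + x = s j *\<^sub>R q + y"
          by (auto simp: A_def)
        have "s i - s j \<in> \<rat>" "s i - s j \<noteq> 0"
          using \<open>i \<noteq> j\<close> by (auto simp: s_def)
        moreover have "\<bar>s i - s j\<bar> < 1 / real (Suc n)"
          using s_bound[of i] s_bound[of j] by linarith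
        ultimately have "x + (s i - s j) *\<^sub>R q \<in> U"
          using xy(1) by (auto simp: N_def)
        moreover have "x + (s i - s j) *\<^sub>R q = y"
          using xy(3) by (simp add: algebra_simps)
        ultimately show False
          using xy(2) by (simp add: N_def)
      qed
    qed
    moreover have "range A \<subseteq> sets lebesgue"
      using A_meas by auto
    moreover have "emeasure lebesgue (\<Union>i. A i) \<noteq> \<infinity>"
    proof -
      have "(\<Union>i. A i) \<subseteq> cball 0 (norm q + real k)"
      proof clarify
        fix x i assume "x \<in> A i"
        then obtain y where y: "y \<in> N n k" "x = s i *\<^sub>R q + y"
          by (auto simp: A_def)
        have "s i \<le> 1"
          by (simp add: s_def inverse_eq_divide)
        then have "norm (s i *\<^sub>R q) \<le> norm q"
          using s_bound(1)[of i] by (simp add: mult_left_le_one_le)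
        moreover have "norm y \<le> real k"
          using y(1) by (simp add: N_def)
        ultimately show "x \<in> cball 0 (norm q + real k)"
          using norm_triangle_ineq[of "s i *\<^sub>R q" y] y(2) by simp
      qed
      moreover have "(\<Union>i. A i) \<in> sets lebesgue"
        using A_meas by (intro sets.countable_UN) auto
      ultimately have "(\<Union>i. A i) \<in> lmeasurable"
        by (meson bounded_cball bounded_set_imp_lmeasurable bounded_subset)
      then show ?thesis
        by (auto simp: fmeasurable_def)
    qed
    \<comment> \<open>Infinitely many disjoint translates of equal measure lie in one ball, so a
      constant series converges and its term is 0.\<close>
    ultimately have "(\<lambda>i. measure lebesgue (A i)) sums measure lebesgue (\<Union>i. A i)"
      by (intro measure_UNION) auto
    then have "summable (\<lambda>i::nat. measure lebesgue (N n k))"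
      unfolding A_def measure_translation by (rule sums_summable)
    then have "measure lebesgue (N n k) = 0"
      using summable_LIMSEQ_zero LIMSEQ_const_iff by blast
    then have "N n k \<in> null_sets lebesgue"
      using meas by (metis fmeasurableD measure_eq_0_null_sets negligible_iff_measure0 negligible_iff_null_sets)
    then show ?thesis
      using N_sets null_sets_completion_iff[of "N n k" lborel] by simp
  qed
  have "AE p in lborel. \<forall>n k. p \<notin> N n k"
    using N_null by (simp add: AE_all_countable AE_not_in)
  then show ?thesis
  proof eventually_elim
    fix p assume notN: "\<forall>n k. p \<notin> N n k"
    show "(\<forall>\<^sub>F s in at 0. p + s *\<^sub>R q \<in> U) \<longrightarrow> p \<in> U"
    proof (intro impI, rule ccontr)
      assume ev: "\<forall>\<^sub>F s in at 0. p + s *\<^sub>R q \<in> U" and "p \<notin> U"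
      obtain e where e: "e > 0" "\<And>s. s \<noteq> 0 \<Longrightarrow> \<bar>s\<bar> < e \<Longrightarrow> p + s *\<^sub>R q \<in> U"
        using ev by (auto simp: eventually_at dist_norm)
      obtain n where n: "1 / real (Suc n) < e"
        using e(1) by (metis nat_approx_posE)
      obtain k where k: "norm p \<le> real k"
        using real_arch_simple by blast
      have "p \<in> N n k"
        using e(2) n k \<open>p \<notin> U\<close> by (auto simp: N_def)
      then show False
        using notN by blast
    qed
  qed
qed

section \<open>Slices by a generic hyperplane\<close>

definition slice :: "'a::euclidean_space \<Rightarrow> 'a set \<Rightarrow> 'a set" where
  "slice p S = {x \<in> S. x \<bullet> p = 0}"

lemma subspace_slice: "subspace S \<Longrightarrow> subspace (slice p S)"
  by (auto simp: slice_def subspace_def inner_add_left)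

text \<open>A point of the slice at \<open>p\<close> is pushed into the slice at \<open>g t\<close>
  by a correction along a fixed \<open>a\<close>. The coefficient tends to 0 because
  \<open>x\<close> is orthogonal to \<open>p\<close> while \<open>a\<close> is not.\<close>

lemma slice_limit:
  assumes "subspace S" "a \<in> S" "a \<bullet> p \<noteq> 0" "x \<in> slice p S" "(g \<longlongrightarrow> p) F"
  shows "((\<lambda>t. x - (x \<bullet> g t / (a \<bullet> g t)) *\<^sub>R a) \<longlongrightarrow> x) F"
    and "\<forall>\<^sub>F t in F. x - (x \<bullet> g t / (a \<bullet> g t)) *\<^sub>R a \<in> slice (g t) S"
proof -
  have "((\<lambda>t. x - (x \<bullet> g t / (a \<bullet> g t)) *\<^sub>R a) \<longlongrightarrow> x - (x \<bullet> p / (a \<bullet> p)) *\<^sub>R a) F"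
    using assms(3,5) by (intro tendsto_intros)
  then show "((\<lambda>t. x - (x \<bullet> g t / (a \<bullet> g t)) *\<^sub>R a) \<longlongrightarrow> x) F"
    using assms(4) by (simp add: slice_def)
  have "((\<lambda>t. a \<bullet> g t) \<longlongrightarrow> a \<bullet> p) F"
    using assms(5) by (intro tendsto_intros)
  then have "\<forall>\<^sub>F t in F. a \<bullet> g t \<noteq> 0"
    using assms(3) by (rule tendsto_imp_eventually_ne)
  then show "\<forall>\<^sub>F t in F. x - (x \<bullet> g t / (a \<bullet> g t)) *\<^sub>R a \<in> slice (g t) S"
  proof eventually_elim
    fix t assume "a \<bullet> g t \<noteq> 0"
    then show "x - (x \<bullet> g t / (a \<bullet> g t)) *\<^sub>R a \<in> slice (g t) S"
      using assms(1,2,4) by (simp add: slice_def inner_diff_left subspace_diff subspace_scale)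
  qed
qed

text \<open>The slices at \<open>p\<close> are limits of nearby slices by
  \<open>slice_limit\<close>. The extra set \<open>B\<close> of limit vectors is what detects a rank
  jump: it is empty in the proof of openness and holds the derivative of a moved dependency
  later.\<close>

lemma dim_slices_lower_semicontinuous:
  assumes "\<And>i. i \<in> I \<Longrightarrow> subspace (S i)" "\<And>i. i \<in> I \<Longrightarrow> \<exists>a\<in>S i. a \<bullet> p \<noteq> 0"
    and "(g \<longlongrightarrow> p) F"
    and "\<And>b. b \<in> B \<Longrightarrow> \<exists>h. (h \<longlongrightarrow> b) F \<and> (\<forall>\<^sub>F t in F. h t \<in> span (\<Union>i\<in>I. slice (g t) (S i)))"
  shows "\<forall>\<^sub>F t in F. dim (B \<union> (\<Union>i\<in>I. slice p (S i))) \<le> dim (\<Union>i\<in>I. slice (g t) (S i))"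
proof -
  have "\<forall>\<^sub>F t in F. dim (B \<union> (\<Union>i\<in>I. slice p (S i))) \<le> dim (span (\<Union>i\<in>I. slice (g t) (S i)))"
  proof (rule dim_lower_semicontinuous)
    fix b assume "b \<in> B \<union> (\<Union>i\<in>I. slice p (S i))"
    then consider "b \<in> B" | i where "i \<in> I" "b \<in> slice p (S i)"
      by blast
    then show "\<exists>h. (h \<longlongrightarrow> b) F \<and> (\<forall>\<^sub>F t in F. h t \<in> span (\<Union>i\<in>I. slice (g t) (S i)))"
    proof cases
      case 1
      then show ?thesis by (rule assms(4))
    next
      case 2
      obtain a where a: "a \<in> S i" "a \<bullet> p \<noteq> 0"
        using assms(2) 2(1) by blast
      note lim = slice_limit[OF assms(1)[OF 2(1)] a 2(2) assms(3)]
      have "\<forall>\<^sub>F t in F. b - (b \<bullet> g t / (a \<bullet> g t)) *\<^sub>R a \<in> span (\<Union>i\<in>I. slice (g t) (S i))"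
        using lim(2) by eventually_elim (use 2(1) in \<open>blast intro: span_base\<close>)
      then show ?thesis
        using lim(1) by blast
    qed
  qed
  then show ?thesis by simp
qed

text \<open>Points orthogonal to a whole \<open>S i\<close> are excluded because there the slice is
  all of \<open>S i\<close>, and the rank may drop at nearby points.\<close>

lemma open_dim_slices_ge:
  assumes "finite I" "\<And>i. i \<in> I \<Longrightarrow> subspace (S i)"
  shows "open {p. (\<forall>i\<in>I. \<exists>a\<in>S i. a \<bullet> p \<noteq> 0) \<and> r \<le> dim (\<Union>i\<in>I. slice p (S i))}" (is "open ?U")
proof (subst open_subopen, rule ballI)
  fix p assume p: "p \<in> ?U"
  have "\<forall>\<^sub>F x in nhds p. dim ({} \<union> (\<Union>i\<in>I. slice p (S i))) \<le> dim (\<Union>i\<in>I. slice x (S i))"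
    using p assms(2) by (intro dim_slices_lower_semicontinuous) (auto simp: filterlim_ident)
  moreover have "\<forall>\<^sub>F x in nhds p. \<forall>i\<in>I. \<exists>a\<in>S i. a \<bullet> x \<noteq> 0"
  proof (rule eventually_ball_finite[OF assms(1)], rule ballI)
    fix i assume "i \<in> I"
    then obtain a where a: "a \<in> S i" "a \<bullet> p \<noteq> 0"
      using p by blast
    have "((\<lambda>x. a \<bullet> x) \<longlongrightarrow> a \<bullet> p) (nhds p)"
      by (intro tendsto_intros filterlim_ident)
    then have "\<forall>\<^sub>F x in nhds p. a \<bullet> x \<noteq> 0"
      using a(2) by (rule tendsto_imp_eventually_ne)
    then show "\<forall>\<^sub>F x in nhds p. \<exists>a\<in>S i. a \<bullet> x \<noteq> 0"
      by eventually_elim (use a(1) in blast)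
  qed
  ultimately have "\<forall>\<^sub>F x in nhds p. x \<in> ?U"
    by eventually_elim (use p in auto)
  then show "\<exists>T. open T \<and> p \<in> T \<and> T \<subseteq> ?U"
    unfolding eventually_nhds by blast
qed

text \<open>A dependency \<open>\<Sum>w\<^sub>i = 0\<close> at \<open>p\<close> is moved along with the hyperplane orthogonal to
  \<open>p + s q\<close>. The derivative at \<open>s = 0\<close> of the moved sum lies in the span of the slices, as
  otherwise the rank would be larger at all \<open>p + s q\<close> with small \<open>s \<noteq> 0\<close>; pairing it with
  \<open>m\<close> gives the claim in direction \<open>q\<close>.\<close>

lemma AE_slices_weighted_dependency:
  fixes S :: "'i \<Rightarrow> 'a::euclidean_space set"
  assumes fin: "finite I" and sub: "\<And>i. i \<in> I \<Longrightarrow> subspace (S i)"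
    and ne: "\<And>i. i \<in> I \<Longrightarrow> \<exists>a\<in>S i. a \<noteq> 0"
  shows "AE p in lborel. (\<forall>i\<in>I. \<exists>a\<in>S i. a \<bullet> p \<noteq> 0) \<and>
    (\<forall>m c w. (\<forall>i\<in>I. \<forall>x\<in>S i. m \<bullet> x = c i * (p \<bullet> x)) \<longrightarrow> (\<forall>i\<in>I. w i \<in> slice p (S i)) \<longrightarrow>
      (\<Sum>i\<in>I. w i) = 0 \<longrightarrow> (\<Sum>i\<in>I. c i *\<^sub>R w i) = 0)"
proof -
  define U where "U r = {p. (\<forall>i\<in>I. \<exists>a\<in>S i. a \<bullet> p \<noteq> 0) \<and> r \<le> dim (\<Union>i\<in>I. slice p (S i))}" for r
  have openU: "open (U r)" for r
    unfolding U_def using fin sub by (rule open_dim_slices_ge)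
  have "AE p in lborel. \<forall>i\<in>I. \<exists>a\<in>S i. a \<bullet> p \<noteq> 0"
  proof (rule AE_finite_allI[OF fin])
    fix i assume "i \<in> I"
    then obtain a where a: "a \<in> S i" "a \<noteq> 0"
      using ne by blast
    have "negligible {p. a \<bullet> p = 0}"
      using a(2) by (intro negligible_hyperplane) auto
    then have "AE p in lebesgue. p \<notin> {p. a \<bullet> p = 0}"
      by (intro AE_not_in) (simp only: negligible_iff_null_sets)
    then have "AE p in lborel. p \<notin> {p. a \<bullet> p = 0}"
      by (simp only: AE_completion_iff)
    then show "AE p in lborel. \<exists>a\<in>S i. a \<bullet> p \<noteq> 0"
      by eventually_elim (use a(1) in blast)
  qed
  \<comment> \<open>Finitely many directions and countably many ranks leave a single null set. Basis
    directions suffice, since the final identity is checked coordinate by coordinate.\<close>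
  moreover have "AE p in lborel. \<forall>q\<in>Basis. \<forall>r. (\<forall>\<^sub>F s in at 0. p + s *\<^sub>R q \<in> U r) \<longrightarrow> p \<in> U r"
    by (rule AE_finite_allI[OF finite_Basis])
      (unfold AE_all_countable, rule allI, rule AE_line_puncture[OF openU])
  ultimately show ?thesis
  proof eventually_elim
    fix p assume nz: "\<forall>i\<in>I. \<exists>a\<in>S i. a \<bullet> p \<noteq> 0"
      and puncture: "\<forall>q\<in>Basis. \<forall>r. (\<forall>\<^sub>F s in at 0. p + s *\<^sub>R q \<in> U r) \<longrightarrow> p \<in> U r"
    obtain a where a: "\<And>i. i \<in> I \<Longrightarrow> a i \<in> S i" "\<And>i. i \<in> I \<Longrightarrow> a i \<bullet> p \<noteq> 0"
      using nz by metis
    define W where "W x = (\<Union>i\<in>I. slice x (S i))" for x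
    have "(\<Sum>i\<in>I. c i *\<^sub>R w i) = 0"
      if m: "\<forall>i\<in>I. \<forall>x\<in>S i. m \<bullet> x = c i * (p \<bullet> x)" and w: "\<forall>i\<in>I. w i \<in> slice p (S i)"
        and sum0: "(\<Sum>i\<in>I. w i) = 0" for m c w
    proof (rule euclidean_eqI)
      fix q :: 'a assume q: "q \<in> Basis"
      \<comment> \<open>As \<open>w i\<close> is orthogonal to \<open>p\<close>, its product with
        \<open>p + s *\<^sub>R q\<close> is \<open>s * (w i \<bullet> q)\<close>. The moved vectors
        therefore sum to \<open>- s *\<^sub>R y s\<close>, and \<open>- y 0\<close> is the
        derivative at 0.\<close>
      define y where "y s = (\<Sum>i\<in>I. (w i \<bullet> q / (a i \<bullet> (p + s *\<^sub>R q))) *\<^sub>R a i)" for s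
      have lim_p: "((\<lambda>s. p + s *\<^sub>R q) \<longlongrightarrow> p) (at 0)"
      proof -
        have "((\<lambda>s. p + s *\<^sub>R q) \<longlongrightarrow> p + 0 *\<^sub>R q) (at 0)"
          by (intro tendsto_intros)
        then show ?thesis by simp
      qed
      have y_lim: "(y \<longlongrightarrow> y 0) (at 0)"
        unfolding y_def by (intro tendsto_intros) (simp add: a(2))
      have "\<forall>\<^sub>F s in at 0. \<forall>i\<in>I.
          w i - (w i \<bullet> (p + s *\<^sub>R q) / (a i \<bullet> (p + s *\<^sub>R q))) *\<^sub>R a i \<in> slice (p + s *\<^sub>R q) (S i)"
        using slice_limit(2)[OF sub a _ lim_p] w fin
        by (intro eventually_ball_finite) auto
      moreover have "\<forall>\<^sub>F s in at (0::real). s \<noteq> 0"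
        by (simp add: eventually_at_filter)
      ultimately have y_mem: "\<forall>\<^sub>F s in at 0. y s \<in> span (W (p + s *\<^sub>R q))"
      proof eventually_elim
        fix s :: real
        assume mem: "\<forall>i\<in>I. w i - (w i \<bullet> (p + s *\<^sub>R q) / (a i \<bullet> (p + s *\<^sub>R q))) *\<^sub>R a i
            \<in> slice (p + s *\<^sub>R q) (S i)" and "s \<noteq> 0"
        have "(\<Sum>i\<in>I. w i - (w i \<bullet> (p + s *\<^sub>R q) / (a i \<bullet> (p + s *\<^sub>R q))) *\<^sub>R a i) =
            - (\<Sum>i\<in>I. (s * (w i \<bullet> q) / (a i \<bullet> (p + s *\<^sub>R q))) *\<^sub>R a i)"
          using w sum0 by (simp add: sum_subtractf slice_def inner_add_right)
        also have "\<dots> = - s *\<^sub>R y s"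
          by (simp add: y_def scaleR_sum_right sum_negf)
        finally have sum_eq: "(\<Sum>i\<in>I. w i - (w i \<bullet> (p + s *\<^sub>R q) / (a i \<bullet> (p + s *\<^sub>R q))) *\<^sub>R a i) =
            - s *\<^sub>R y s" .
        have "- s *\<^sub>R y s \<in> span (W (p + s *\<^sub>R q))"
          unfolding sum_eq[symmetric] using mem by (intro span_sum span_base) (auto simp: W_def)
        then have "(- inverse s) *\<^sub>R (- s *\<^sub>R y s) \<in> span (W (p + s *\<^sub>R q))"
          by (rule span_scale)
        then show "y s \<in> span (W (p + s *\<^sub>R q))"
          using \<open>s \<noteq> 0\<close> by simp
      qed
      have "y 0 \<in> span (W p)"
      proof (rule ccontr)
        assume "y 0 \<notin> span (W p)"
        then have dim: "dim ({y 0} \<union> W p) = Suc (dim (W p))"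
          by (simp add: dim_insert)
        have "\<forall>\<^sub>F s in at 0. dim ({y 0} \<union> W p) \<le> dim (W (p + s *\<^sub>R q))"
        proof (unfold W_def, rule dim_slices_lower_semicontinuous)
          show "\<And>i. i \<in> I \<Longrightarrow> subspace (S i)" "\<And>i. i \<in> I \<Longrightarrow> \<exists>a\<in>S i. a \<bullet> p \<noteq> 0"
            using sub nz by auto
          show "((\<lambda>s. p + s *\<^sub>R q) \<longlongrightarrow> p) (at 0)"
            by (rule lim_p)
          show "\<exists>h. (h \<longlongrightarrow> b) (at 0) \<and>
              (\<forall>\<^sub>F s in at 0. h s \<in> span (\<Union>i\<in>I. slice (p + s *\<^sub>R q) (S i)))"
            if "b \<in> {y 0}" for b
            using that y_lim y_mem by (auto simp: W_def)
        qed
        \<comment> \<open>For \<open>r = 0\<close> the rank bound is void, so \<open>U 0\<close>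
          records only that no \<open>S i\<close> is orthogonal to the point.\<close>
        moreover have "\<forall>\<^sub>F s in at 0. p + s *\<^sub>R q \<in> U 0"
          using nz by (intro topological_tendstoD[OF lim_p openU]) (simp add: U_def)
        ultimately have "\<forall>\<^sub>F s in at 0. p + s *\<^sub>R q \<in> U (Suc (dim (W p)))"
          by eventually_elim (use dim in \<open>auto simp: U_def W_def\<close>)
        then have "p \<in> U (Suc (dim (W p)))"
          using puncture q by blast
        then show False
          by (auto simp: U_def W_def)
      qed
      moreover have "orthogonal m x" if "x \<in> W p" for x
        using that m by (force simp: W_def slice_def orthogonal_def inner_commute[of p])
      ultimately have "m \<bullet> y 0 = 0"
        using orthogonal_to_span[of "y 0" "W p" m] by (simp add: orthogonal_def)
      \<comment> \<open>On \<open>a i\<close> the vector \<open>m\<close> is \<open>c i\<close>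
        times \<open>p\<close>, which cancels the denominators at \<open>s = 0\<close> and leaves
        the \<open>q\<close>-coordinate of the reweighted sum.\<close>
      moreover have "m \<bullet> y 0 = (\<Sum>i\<in>I. c i * (w i \<bullet> q))"
        using m a unfolding y_def
        by (auto simp: inner_sum_right inner_commute[of p] intro!: sum.cong)
      ultimately show "(\<Sum>i\<in>I. c i *\<^sub>R w i) \<bullet> q = 0 \<bullet> q"
        by (simp add: inner_sum_left)
    qed
    then show "(\<forall>i\<in>I. \<exists>a\<in>S i. a \<bullet> p \<noteq> 0) \<and>
      (\<forall>m c w. (\<forall>i\<in>I. \<forall>x\<in>S i. m \<bullet> x = c i * (p \<bullet> x)) \<longrightarrow> (\<forall>i\<in>I. w i \<in> slice p (S i)) \<longrightarrow>
      (\<Sum>i\<in>I. w i) = 0 \<longrightarrow> (\<Sum>i\<in>I. c i *\<^sub>R w i) = 0)"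
      using nz by blast
  qed
qed

section \<open>Dilworth truncation of subspaces\<close>

lemma dim_Un_le:
  fixes A B :: "'a::euclidean_space set"
  shows "dim (A \<union> B) \<le> dim A + dim B"
proof -
  have "dim (A \<union> B) = dim (span (A \<union> B))"
    by simp
  also have "\<dots> = dim {x + y |x y. x \<in> span A \<and> y \<in> span B}"
    by (simp only: span_Un)
  also have "\<dots> \<le> dim (span A) + dim (span B)"
    using dim_sums_Int[OF subspace_span[of A] subspace_span[of B]] by linarith
  finally show ?thesis by simp
qed

lemma dim_UN_le:
  fixes T :: "'i \<Rightarrow> 'a::euclidean_space set"
  assumes "finite I"
  shows "dim (\<Union>i\<in>I. T i) \<le> (\<Sum>i\<in>I. dim (T i))"
  using assms
proof induction
  case (insert i I)
  then show ?case
    using dim_Un_le[of "T i" "\<Union>i\<in>I. T i"] by simp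
qed simp

lemma span_UN_sum:
  fixes T :: "'i \<Rightarrow> 'a::euclidean_space set"
  assumes "finite I" "\<And>i. i \<in> I \<Longrightarrow> subspace (T i)" "x \<in> span (\<Union>i\<in>I. T i)"
  shows "\<exists>w. (\<forall>i\<in>I. w i \<in> T i) \<and> x = (\<Sum>i\<in>I. w i)"
  using assms
proof (induction arbitrary: x)
  case (insert i I)
  from insert.prems(2) obtain y z where yz: "x = y + z" "y \<in> span (T i)" "z \<in> span (\<Union>i\<in>I. T i)"
    by (auto simp: span_Un)
  obtain w where w: "\<forall>i\<in>I. w i \<in> T i" "z = (\<Sum>i\<in>I. w i)"
    using insert.IH[of z] insert.prems(1) yz(3) by auto
  have "y \<in> T i"
    using yz(2) insert.prems(1)[of i] span_eq_iff by blast
  moreover have "x = (\<Sum>j\<in>insert i I. (w(i := y)) j)"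
    using insert.hyps yz(1) w(2) by (auto intro!: sum.cong)
  ultimately show ?case
    using w(1) insert.hyps by (intro exI[of _ "w(i := y)"]) auto
qed simp

lemma dim_UN_direct:
  fixes T :: "'i \<Rightarrow> 'a::euclidean_space set"
  assumes "finite I" "\<And>i. i \<in> I \<Longrightarrow> subspace (T i)"
    and "\<And>w i. \<lbrakk>\<And>j. j \<in> I \<Longrightarrow> w j \<in> T j; (\<Sum>j\<in>I. w j) = 0; i \<in> I\<rbrakk> \<Longrightarrow> w i = 0"
  shows "dim (\<Union>i\<in>I. T i) = (\<Sum>i\<in>I. dim (T i))"
  using assms
proof induction
  case (insert i I)
  have sub: "subspace (T i)" "\<And>j. j \<in> I \<Longrightarrow> subspace (T j)"
    using insert.prems(1) by auto
  have "w j = 0" if w: "\<And>j. j \<in> I \<Longrightarrow> w j \<in> T j" "(\<Sum>j\<in>I. w j) = 0" and j: "j \<in> I" for w j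
  proof -
    have mem: "(w(i := 0)) k \<in> T k" if "k \<in> insert i I" for k
      using that w(1) sub(1) by (auto simp: subspace_0)
    have "(\<Sum>k\<in>insert i I. (w(i := 0)) k) = (\<Sum>k\<in>I. w k)"
      using insert.hyps by (auto intro!: sum.cong)
    then have "(w(i := 0)) j = 0"
      using insert.prems(2)[of "w(i := 0)" j, OF mem] w(2) j by simp
    moreover have "j \<noteq> i"
      using j insert.hyps by blast
    ultimately show ?thesis
      by simp
  qed
  then have IH: "dim (\<Union>j\<in>I. T j) = (\<Sum>j\<in>I. dim (T j))"
    using sub(2) by (intro insert.IH) auto
  have "x = 0" if x: "x \<in> T i" "x \<in> span (\<Union>j\<in>I. T j)" for x
  proof -
    obtain w where w: "\<forall>j\<in>I. w j \<in> T j" "x = (\<Sum>j\<in>I. w j)"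
      using span_UN_sum[OF insert.hyps(1) sub(2) x(2)] by auto
    \<comment> \<open>A common vector of \<open>T i\<close> and the span of the others is a
      dependency with entry \<open>- x\<close> at \<open>i\<close>.\<close>
    have mem: "(w(i := - x)) k \<in> T k" if "k \<in> insert i I" for k
      using that w(1) x(1) sub(1) by (auto simp: subspace_neg)
    have "(\<Sum>k\<in>insert i I. (w(i := - x)) k) = - x + (\<Sum>k\<in>I. w k)"
      using insert.hyps by (auto intro!: sum.cong)
    then have "(w(i := - x)) i = 0"
      using insert.prems(2)[of "w(i := - x)" i, OF mem] w(2) by simp
    then show ?thesis by simp
  qed
  moreover have "span (T i) = T i"
    using sub(1) by (simp add: span_eq_iff)
  ultimately have "span (T i) \<inter> span (\<Union>j\<in>I. T j) \<subseteq> {0}"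
    by (metis IntE insertCI subsetI)
  then have int0: "dim (span (T i) \<inter> span (\<Union>j\<in>I. T j)) = 0"
    by simp
  have "dim (T i \<union> (\<Union>j\<in>I. T j)) = dim (span (T i \<union> (\<Union>j\<in>I. T j)))"
    by simp
  also have "\<dots> = dim {x + y |x y. x \<in> span (T i) \<and> y \<in> span (\<Union>j\<in>I. T j)}"
    by (simp only: span_Un)
  also have "\<dots> = dim (T i) + dim (\<Union>j\<in>I. T j)"
    using dim_sums_Int[OF subspace_span[of "T i"] subspace_span[of "\<Union>j\<in>I. T j"]] int0
    by simp
  finally have "dim (T i \<union> (\<Union>j\<in>I. T j)) = dim (T i) + dim (\<Union>j\<in>I. T j)" .
  then show ?case
    using insert.hyps IH by simp
qed simp

text \<open>The component of \<open>x\<close> orthogonal to \<open>span W\<close> serves as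
  \<open>m\<close>.\<close>

lemma exists_orthogonal_detecting:
  fixes x :: "'a::euclidean_space"
  assumes "x \<notin> span W"
  shows "\<exists>m. (\<forall>y\<in>W. m \<bullet> y = 0) \<and> m \<bullet> x \<noteq> 0"
proof -
  obtain y z where yz: "y \<in> span W" "\<And>w. w \<in> span W \<Longrightarrow> orthogonal z w" "x = y + z"
    by (rule orthogonal_subspace_decomp_exists[of W x]) blast
  have "z \<noteq> 0"
    using yz assms by auto
  moreover have "z \<bullet> y = 0"
    using yz(1,2) by (simp add: orthogonal_def)
  ultimately have "z \<bullet> x \<noteq> 0"
    by (simp add: yz(3) inner_add_right)
  then show ?thesis
    using yz(2) span_base unfolding orthogonal_def by blast
qed

text \<open>Each \<open>x\<close> in \<open>S\<close> is a slice vector plus a multiple of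
  \<open>a\<close>. This is the source of the \<open>- 1\<close> in the truncated function.\<close>

lemma dim_eq_Suc_dim_slice:
  assumes "subspace S" "a \<in> S" "a \<bullet> p \<noteq> 0"
  shows "dim S = Suc (dim (slice p S))"
proof -
  have "span (slice p S) = slice p S"
    using assms(1) by (simp add: subspace_slice span_eq_iff)
  moreover have "a \<notin> slice p S"
    using assms(3) by (simp add: slice_def)
  ultimately have "a \<notin> span (slice p S)"
    by metis
  then have "dim (insert a (slice p S)) = Suc (dim (slice p S))"
    by (simp add: dim_insert)
  moreover have "S \<subseteq> span (insert a (slice p S))"
  proof
    fix x assume "x \<in> S"
    then have "x - (x \<bullet> p / (a \<bullet> p)) *\<^sub>R a \<in> slice p S"
      using assms by (simp add: slice_def subspace_diff subspace_scale inner_diff_left)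
    then show "x \<in> span (insert a (slice p S))"
      unfolding span_insert using span_base by blast
  qed
  moreover have "insert a (slice p S) \<subseteq> S"
    using assms(2) by (auto simp: slice_def)
  ultimately show ?thesis
    by (metis dim_span dim_subset le_antisym)
qed

text \<open>If a non-zero dependency could be reweighted by two different factors at indices \<open>i\<close> and
  \<open>j\<close> of its support, then subtracting a multiple would give a dependency of smaller support.\<close>

lemma dependency_zero_if_reweightable:
  fixes w :: "'i \<Rightarrow> 'a::euclidean_space"
  assumes fin: "finite I" and sub: "\<And>i. i \<in> I \<Longrightarrow> subspace (T i)"
    and sep: "\<And>i j. \<lbrakk>i \<in> I; j \<in> I; i \<noteq> j\<rbrakk> \<Longrightarrow> \<exists>c::'i \<Rightarrow> real. c i \<noteq> c j \<and>
      (\<forall>w. (\<forall>k\<in>I. w k \<in> T k) \<longrightarrow> (\<Sum>k\<in>I. w k) = 0 \<longrightarrow> (\<Sum>k\<in>I. c k *\<^sub>R w k) = 0)"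
    and "\<And>k. k \<in> I \<Longrightarrow> w k \<in> T k" "(\<Sum>k\<in>I. w k) = 0" "i \<in> I"
  shows "w i = 0"
  using assms(4-)
proof (induction "card {k \<in> I. w k \<noteq> 0}" arbitrary: w i rule: less_induct)
  case (less w)
  show ?case
  proof (rule ccontr)
    assume "w i \<noteq> 0"
    have "w j = 0" if j: "j \<in> I" "j \<noteq> i" for j
    proof -
      obtain c where c: "c i \<noteq> c j"
        "\<And>w. (\<forall>k\<in>I. w k \<in> T k) \<Longrightarrow> (\<Sum>k\<in>I. w k) = 0 \<Longrightarrow> (\<Sum>k\<in>I. c k *\<^sub>R w k) = 0"
        using sep[of i j] less.prems(3) j by blast
      \<comment> \<open>The reweighted dependency minus \<open>c i\<close> times the original: entry
        \<open>i\<close> dies and no new entry appears, so induction gives \<open>w' j = 0\<close>,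
        and \<open>c i \<noteq> c j\<close> then gives \<open>w j = 0\<close>.\<close>
      define w' where "w' k = (c k - c i) *\<^sub>R w k" for k
      have "{k \<in> I. w' k \<noteq> 0} \<subset> {k \<in> I. w k \<noteq> 0}"
        using less.prems(3) \<open>w i \<noteq> 0\<close> by (auto simp: w'_def)
      then have "card {k \<in> I. w' k \<noteq> 0} < card {k \<in> I. w k \<noteq> 0}"
        using fin by (intro psubset_card_mono) auto
      moreover have "(\<Sum>k\<in>I. w' k) = (\<Sum>k\<in>I. c k *\<^sub>R w k) - c i *\<^sub>R (\<Sum>k\<in>I. w k)"
        by (simp add: w'_def scaleR_diff_left sum_subtractf scaleR_sum_right)
      then have "(\<Sum>k\<in>I. w' k) = 0"
        using c(2)[of w] less.prems by simp
      moreover have "w' k \<in> T k" if "k \<in> I" for k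
        using that less.prems(1) sub by (simp add: w'_def subspace_scale)
      ultimately have "w' j = 0"
        using less.hyps[of w' j] j by blast
      then show ?thesis
        using c(1) by (simp add: w'_def)
    qed
    then have "(\<Sum>k\<in>I. w k) = (\<Sum>k\<in>{i}. w k)"
      using fin less.prems(3) by (intro sum.mono_neutral_right) auto
    then show False
      using less.prems(2) \<open>w i \<noteq> 0\<close> by simp
  qed
qed

section \<open>Minima over partitions and Lovasz's theorem\<close>

lemma hat_le_sum:
  assumes "finite F" "partition_on F P"
  shows "hat f F \<le> (\<Sum>X\<in>P. f X)"
proof (cases "F = {}")
  \<comment> \<open>The only partition of the empty set is the empty one, whose sum is the value 0
    that \<open>hat\<close> takes there.\<close>
  case True
  then show ?thesis
    using assms(2) by (simp add: hat_def partition_on_empty)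
next
  case False
  have "finite {\<Sum>X\<in>P. f X | P. partition_on F P}"
    using finitely_many_partition_on[OF assms(1)] by simp
  then show ?thesis
    using False assms(2) by (auto simp: hat_def intro!: Min_le)
qed

lemma hat_attained:
  assumes "finite F"
  obtains P where "partition_on F P" "hat f F = (\<Sum>X\<in>P. f X)"
proof (cases "F = {}")
  case True
  then show ?thesis
    using that[of "{}"] by (simp add: hat_def partition_on_empty)
next
  case False
  have "finite {\<Sum>X\<in>P. f X | P. partition_on F P}"
    using finitely_many_partition_on[OF assms(1)] by simp
  moreover have "{\<Sum>X\<in>P. f X | P. partition_on F P} \<noteq> {}"
    using partition_on_space[OF False] by blast
  ultimately have "hat f F \<in> {\<Sum>X\<in>P. f X | P. partition_on F P}"
    using False Min_in[of "{\<Sum>X\<in>P. f X | P. partition_on F P}"] by (simp add: hat_def)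
  then show ?thesis
    using that by blast
qed

text \<open>The partition is by the lines that the \<open>A e\<close> become modulo the span of the slices.\<close>

lemma exists_partition_dim_slices_ge:
  fixes A :: "'e \<Rightarrow> 'a::euclidean_space set"
  assumes fin: "finite F" and sub: "\<And>e. e \<in> F \<Longrightarrow> subspace (A e)"
    and nz: "\<And>e. e \<in> F \<Longrightarrow> \<exists>a\<in>A e. a \<bullet> p \<noteq> 0"
    and gen: "\<And>P m c w. \<lbrakk>partition_on F P;
      \<forall>X\<in>P. \<forall>x\<in>span (\<Union>e\<in>X. A e). m \<bullet> x = c X * (p \<bullet> x);
      \<forall>X\<in>P. w X \<in> slice p (span (\<Union>e\<in>X. A e)); (\<Sum>X\<in>P. w X) = 0\<rbrakk> \<Longrightarrow> (\<Sum>X\<in>P. c X *\<^sub>R w X) = 0"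
  shows "\<exists>P. partition_on F P \<and>
    (\<Sum>X\<in>P. int (dim (\<Union>e\<in>X. A e)) - 1) \<le> int (dim (\<Union>e\<in>F. slice p (A e)))"
proof -
  define W where "W = (\<Union>e\<in>F. slice p (A e))"
  have "\<exists>a\<in>A e. a \<bullet> p = 1" if e: "e \<in> F" for e
  proof -
    obtain a where "a \<in> A e" "a \<bullet> p \<noteq> 0"
      using nz e by blast
    then show ?thesis
      using sub[OF e] by (intro bexI[of _ "(1 / (a \<bullet> p)) *\<^sub>R a"]) (auto simp: subspace_scale)
  qed
  then obtain a where a: "\<And>e. e \<in> F \<Longrightarrow> a e \<in> A e" "\<And>e. e \<in> F \<Longrightarrow> a e \<bullet> p = 1"
    by metis
  \<comment> \<open>Each \<open>A e\<close> is its slice plus the line of \<open>a e\<close>.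
    Pairing with \<open>p\<close> gives 1 on every \<open>a e\<close> and 0 on \<open>W\<close>, so
    two such lines agree modulo \<open>span W\<close> exactly when the difference of the normalised
    vectors lies in \<open>span W\<close>.\<close>
  define r where "r = {(e, e'). e \<in> F \<and> e' \<in> F \<and> a e - a e' \<in> span W}"
  have "equiv F r"
  proof (rule equivI)
    show "r \<subseteq> F \<times> F" "refl_on F r"
      by (auto simp: r_def refl_on_def span_0)
    show "sym r"
    proof (rule symI)
      fix e e' assume "(e, e') \<in> r"
      then show "(e', e) \<in> r"
        using span_neg[of "a e - a e'" W] by (simp add: r_def)
    qed
    show "trans r"
    proof (rule transI)
      fix e e' e'' assume "(e, e') \<in> r" "(e', e'') \<in> r"
      then show "(e, e'') \<in> r"
        using span_add[of "a e - a e'" W "a e' - a e''"] by (simp add: r_def)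
    qed
  qed
  define P where "P = F // r"
  have P: "partition_on F P"
    unfolding P_def by (rule partition_on_quotient) fact
  have finP: "finite P"
    using fin P by (rule finite_elements)
  have F_mem: "e \<in> F" if "X \<in> P" "e \<in> X" for X e
    using partition_onD1[OF P] that by blast
  have same: "a e - a e' \<in> span W" if "X \<in> P" "e \<in> X" "e' \<in> X" for X e e'
    using that quotient_eq_iff[OF \<open>equiv F r\<close>, of X X e e'] by (simp add: P_def r_def)
  define S where "S X = span (\<Union>e\<in>X. A e)" for X
  \<comment> \<open>On \<open>A f\<close> a vector differs from a multiple of \<open>a f\<close> by
    a slice vector, which \<open>m\<close> kills, and \<open>a f\<close> may be replaced by
    \<open>a e\<close> within a class. The identity then passes to the span by linearity.\<close>
  have multiple: "m \<bullet> x = (m \<bullet> a e) * (p \<bullet> x)"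
    if m: "\<forall>y\<in>W. m \<bullet> y = 0" and X: "X \<in> P" "e \<in> X" and x: "x \<in> S X" for m X e x
  proof -
    have m_span: "m \<bullet> y = 0" if "y \<in> span W" for y
      using orthogonal_to_span[OF that, of m] m by (simp add: orthogonal_def)
    have "(\<Union>f\<in>X. A f) \<subseteq> {x. m \<bullet> x = (m \<bullet> a e) * (p \<bullet> x)}"
    proof clarify
      fix x f assume f: "f \<in> X" "x \<in> A f"
      then have fF: "f \<in> F"
        using F_mem X by blast
      have "x - (x \<bullet> p) *\<^sub>R a f \<in> slice p (A f)"
        using f(2) a[OF fF] sub[OF fF]
        by (simp add: slice_def subspace_diff subspace_scale inner_diff_left)
      then have "m \<bullet> (x - (x \<bullet> p) *\<^sub>R a f) = 0"
        using m fF by (auto simp: W_def)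
      moreover have "m \<bullet> (a e - a f) = 0"
        using m_span same X f(1) by blast
      ultimately show "m \<bullet> x = (m \<bullet> a e) * (p \<bullet> x)"
        by (simp add: inner_diff_right inner_commute)
    qed
    moreover have "subspace {x. m \<bullet> x = (m \<bullet> a e) * (p \<bullet> x)}"
      by (simp add: subspace_def inner_add_right distrib_left)
    ultimately show ?thesis
      using x span_minimal unfolding S_def by blast
  qed
  have nonempty: "\<exists>e. e \<in> X" if "X \<in> P" for X
    using partition_onD3[OF P] that by (metis ex_in_conv)
  \<comment> \<open>By \<open>multiple\<close>, every \<open>m\<close> orthogonal to
    \<open>W\<close> vanishes on the vectors of \<open>S X\<close> orthogonal to \<open>p\<close>,
    so none can detect such a vector outside \<open>span W\<close>.\<close>
  have "slice p (S X) \<subseteq> span W" if X: "X \<in> P" for X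
  proof (rule subsetI, rule ccontr)
    fix x assume x: "x \<in> slice p (S X)" "x \<notin> span W"
    obtain m where m: "\<forall>y\<in>W. m \<bullet> y = 0" "m \<bullet> x \<noteq> 0"
      using exists_orthogonal_detecting[OF x(2)] by blast
    obtain e where "e \<in> X"
      using nonempty[OF X] by blast
    then show False
      using multiple[OF m(1) X, of e x] x(1) m(2) by (simp add: slice_def inner_commute)
  qed
  then have "dim (\<Union>X\<in>P. slice p (S X)) \<le> dim (span W)"
    by (intro dim_subset) blast
  moreover have "dim (\<Union>X\<in>P. slice p (S X)) = (\<Sum>X\<in>P. dim (slice p (S X)))"
  proof (rule dim_UN_direct[OF finP])
    show sub_slice: "\<And>X. subspace (slice p (S X))"
      by (simp add: S_def subspace_slice)
    fix w X
    assume w: "\<And>Y. Y \<in> P \<Longrightarrow> w Y \<in> slice p (S Y)" "(\<Sum>Y\<in>P. w Y) = 0" "X \<in> P"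
    have "\<exists>c::'e set \<Rightarrow> real. c X \<noteq> c Y \<and> (\<forall>w. (\<forall>Z\<in>P. w Z \<in> slice p (S Z)) \<longrightarrow> (\<Sum>Z\<in>P. w Z) = 0 \<longrightarrow>
        (\<Sum>Z\<in>P. c Z *\<^sub>R w Z) = 0)" if XY: "X \<in> P" "Y \<in> P" "X \<noteq> Y" for X Y
    proof -
      define g where "g Z = (SOME e. e \<in> Z)" for Z :: "'e set"
      have g: "g Z \<in> Z" if "Z \<in> P" for Z
        using nonempty[OF that] unfolding g_def by (rule someI_ex)
      \<comment> \<open>Representatives of different classes differ modulo \<open>span W\<close>, so
        some \<open>m\<close> orthogonal to \<open>W\<close> takes different values on them. These
        values are the factors that \<open>multiple\<close> yields, and genericity makes them a
        valid reweighting.\<close>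
      have "a (g X) - a (g Y) \<notin> span W"
      proof
        assume "a (g X) - a (g Y) \<in> span W"
        then have "(g X, g Y) \<in> r"
          using g XY F_mem by (simp add: r_def)
        then show False
          using quotient_eq_iff[OF \<open>equiv F r\<close>, of X Y "g X" "g Y"] g XY by (simp add: P_def)
      qed
      then obtain m where m: "\<forall>y\<in>W. m \<bullet> y = 0" "m \<bullet> (a (g X) - a (g Y)) \<noteq> 0"
        using exists_orthogonal_detecting by blast
      have "\<forall>Z\<in>P. \<forall>x\<in>S Z. m \<bullet> x = (m \<bullet> a (g Z)) * (p \<bullet> x)"
        using multiple[OF m(1)] g by blast
      then have "\<forall>w. (\<forall>Z\<in>P. w Z \<in> slice p (S Z)) \<longrightarrow> (\<Sum>Z\<in>P. w Z) = 0 \<longrightarrow>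
          (\<Sum>Z\<in>P. (m \<bullet> a (g Z)) *\<^sub>R w Z) = 0"
        using gen[OF P, of m "\<lambda>Z. m \<bullet> a (g Z)"] unfolding S_def by blast
      then show ?thesis
        using m(2) by (intro exI[of _ "\<lambda>Z. m \<bullet> a (g Z)"]) (simp add: inner_diff_right)
    qed
    then show "w X = 0"
      using dependency_zero_if_reweightable[OF finP, of "\<lambda>Z. slice p (S Z)" w X] w sub_slice
      by blast
  qed
  moreover have dimS: "int (dim (\<Union>e\<in>X. A e)) - 1 = int (dim (slice p (S X)))" if X: "X \<in> P" for X
  proof -
    obtain e where e: "e \<in> X"
      using nonempty[OF X] by blast
    then have "a e \<in> S X" "a e \<bullet> p \<noteq> 0"
      using a[OF F_mem[OF X e]] by (auto simp: S_def intro: span_base)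
    then have "dim (S X) = Suc (dim (slice p (S X)))"
      by (intro dim_eq_Suc_dim_slice) (simp_all add: S_def)
    then show ?thesis
      by (simp add: S_def)
  qed
  have "(\<Sum>X\<in>P. int (dim (\<Union>e\<in>X. A e)) - 1) = int (\<Sum>X\<in>P. dim (slice p (S X)))"
    unfolding of_nat_sum by (rule sum.cong) (simp_all add: dimS)
  ultimately have "(\<Sum>X\<in>P. int (dim (\<Union>e\<in>X. A e)) - 1) \<le> int (dim W)"
    by (simp del: of_nat_sum)
  then show ?thesis
    using P unfolding W_def by blast
qed

text \<open>The slices of the members of a part lie in the slice of its span, whose dimension is one
  less than that of the span; the dimensions are then added over the parts.\<close>

lemma dim_slices_le_partition:
  fixes A :: "'e \<Rightarrow> 'a::euclidean_space set"
  assumes fin: "finite F" and nz: "\<And>e. e \<in> F \<Longrightarrow> \<exists>a\<in>A e. a \<bullet> p \<noteq> 0" and P: "partition_on F P"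
  shows "int (dim (\<Union>e\<in>F. slice p (A e))) \<le> (\<Sum>X\<in>P. int (dim (\<Union>e\<in>X. A e)) - 1)"
proof -
  define S where "S X = span (\<Union>e\<in>X. A e)" for X
  have "(\<Union>e\<in>F. slice p (A e)) \<subseteq> (\<Union>X\<in>P. slice p (S X))"
  proof
    fix x assume "x \<in> (\<Union>e\<in>F. slice p (A e))"
    then obtain e where e: "e \<in> F" "x \<in> slice p (A e)"
      by blast
    then obtain X where X: "X \<in> P" "e \<in> X"
      using partition_onD1[OF P] by blast
    then have "x \<in> slice p (S X)"
      using e(2) by (auto simp: S_def slice_def intro: span_base)
    then show "x \<in> (\<Union>X\<in>P. slice p (S X))"
      using X(1) by blast
  qed
  then have "dim (\<Union>e\<in>F. slice p (A e)) \<le> dim (\<Union>X\<in>P. slice p (S X))"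
    by (rule dim_subset)
  also have "\<dots> \<le> (\<Sum>X\<in>P. dim (slice p (S X)))"
    using finite_elements[OF fin P] by (rule dim_UN_le)
  finally have "int (dim (\<Union>e\<in>F. slice p (A e))) \<le> (\<Sum>X\<in>P. int (dim (slice p (S X))))"
    by (simp flip: of_nat_sum)
  also have "\<dots> = (\<Sum>X\<in>P. int (dim (\<Union>e\<in>X. A e)) - 1)"
  proof (rule sum.cong[OF refl])
    fix X assume X: "X \<in> P"
    \<comment> \<open>A nonempty part has a member not orthogonal to \<open>p\<close>, so slicing
      its span really loses a dimension.\<close>
    then have "X \<noteq> {}"
      using partition_onD3[OF P] by auto
    then obtain e where e: "e \<in> X"
      by blast
    then obtain a where "a \<in> A e" "a \<bullet> p \<noteq> 0"
      using nz partition_onD1[OF P] X by blast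
    then have "dim (S X) = Suc (dim (slice p (S X)))"
      using e by (intro dim_eq_Suc_dim_slice[of _ a]) (auto simp: S_def intro: span_base)
    then show "int (dim (slice p (S X))) = int (dim (\<Union>e\<in>X. A e)) - 1"
      by (simp add: S_def)
  qed
  finally show ?thesis .
qed

theorem Lovasz_generic_hyperplane:
  fixes A :: "'e \<Rightarrow> 'a::euclidean_space set"
  assumes fin: "finite E" and sub: "\<And>e. e \<in> E \<Longrightarrow> subspace (A e)"
    and ne: "\<And>e. e \<in> E \<Longrightarrow> \<exists>a\<in>A e. a \<noteq> 0"
  shows "AE p in lborel. \<forall>F\<subseteq>E.
    int (dim (\<Union>e\<in>F. slice p (A e))) = hat (\<lambda>X. int (dim (\<Union>e\<in>X. A e)) - 1) F"
proof -
  define S where "S X = span (\<Union>e\<in>X. A e)" for X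
  define gen where "gen P p \<longleftrightarrow> (\<forall>X\<in>P. \<exists>a\<in>S X. a \<bullet> p \<noteq> 0) \<and>
    (\<forall>m c w. (\<forall>X\<in>P. \<forall>x\<in>S X. m \<bullet> x = c X * (p \<bullet> x)) \<longrightarrow> (\<forall>X\<in>P. w X \<in> slice p (S X)) \<longrightarrow>
      (\<Sum>X\<in>P. w X) = 0 \<longrightarrow> (\<Sum>X\<in>P. c X *\<^sub>R w X) = 0)" for P p
  \<comment> \<open>There are finitely many families of nonempty subsets of \<open>E\<close>, and
    every partition of every \<open>F\<close> is among them, so one null set serves all.\<close>
  have "AE p in lborel. \<forall>P\<in>{P. P \<subseteq> Pow E \<and> {} \<notin> P}. gen P p"
  proof (rule AE_finite_allI)
    show "finite {P. P \<subseteq> Pow E \<and> {} \<notin> P}"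
      using fin by (auto intro: rev_finite_subset[of "Pow (Pow E)"])
    fix P assume P: "P \<in> {P. P \<subseteq> Pow E \<and> {} \<notin> P}"
    have "\<exists>a\<in>S X. a \<noteq> 0" if X: "X \<in> P" for X
    proof -
      have "X \<noteq> {}" "X \<subseteq> E"
        using P X by auto
      then obtain e where "e \<in> X" "e \<in> E"
        by blast
      then show ?thesis
        using ne[of e] by (auto simp: S_def intro: span_base)
    qed
    moreover have "finite P"
      using P fin by (auto intro: finite_subset)
    ultimately show "AE p in lborel. gen P p"
      unfolding gen_def by (intro AE_slices_weighted_dependency) (auto simp: S_def)
  qed
  then show ?thesis
  proof eventually_elim
    fix p assume gen: "\<forall>P\<in>{P. P \<subseteq> Pow E \<and> {} \<notin> P}. gen P p"
    have nz: "\<exists>a\<in>A e. a \<bullet> p \<noteq> 0" if e: "e \<in> E" for e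
    proof -
      \<comment> \<open>The one-part family \<open>{{e}}\<close> shows that \<open>A e\<close>
        itself is not orthogonal to \<open>p\<close>.\<close>
      have "gen {{e}} p"
        using gen e by auto
      moreover have "S {e} = A e"
        using sub[OF e] by (simp add: S_def span_eq_iff)
      ultimately show ?thesis
        by (simp add: gen_def)
    qed
    show "\<forall>F\<subseteq>E. int (dim (\<Union>e\<in>F. slice p (A e))) = hat (\<lambda>X. int (dim (\<Union>e\<in>X. A e)) - 1) F"
    proof (intro allI impI)
      fix F assume F: "F \<subseteq> E"
      then have finF: "finite F"
        using fin finite_subset by blast
      have genP: "gen P p" if "partition_on F P" for P
        using gen F partition_onD1[OF that] partition_onD3[OF that] by blast
      obtain P where "partition_on F P"
          "(\<Sum>X\<in>P. int (dim (\<Union>e\<in>X. A e)) - 1) \<le> int (dim (\<Union>e\<in>F. slice p (A e)))"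
      proof -
        have "\<exists>P. partition_on F P \<and>
            (\<Sum>X\<in>P. int (dim (\<Union>e\<in>X. A e)) - 1) \<le> int (dim (\<Union>e\<in>F. slice p (A e)))"
          using finF F sub nz genP unfolding gen_def S_def
          by - (rule exists_partition_dim_slices_ge, blast+)
        then show ?thesis
          using that by blast
      qed
      then have "hat (\<lambda>X. int (dim (\<Union>e\<in>X. A e)) - 1) F \<le> int (dim (\<Union>e\<in>F. slice p (A e)))"
        using hat_le_sum[OF finF] order_trans by blast
      moreover obtain P where P: "partition_on F P" "hat (\<lambda>X. int (dim (\<Union>e\<in>X. A e)) - 1) F =
          (\<Sum>X\<in>P. int (dim (\<Union>e\<in>X. A e)) - 1)"
        by (rule hat_attained[OF finF])
      moreover have "int (dim (\<Union>e\<in>F. slice p (A e))) \<le> (\<Sum>X\<in>P. int (dim (\<Union>e\<in>X. A e)) - 1)"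
        using nz F by (intro dim_slices_le_partition[OF finF _ P(1)]) blast
      ultimately show "int (dim (\<Union>e\<in>F. slice p (A e))) = hat (\<lambda>X. int (dim (\<Union>e\<in>X. A e)) - 1) F"
        using P(2) by linarith
    qed
  qed
qed

section \<open>Edge spaces\<close>

definition edge_space :: "('e \<Rightarrow> 'v::finite set) \<Rightarrow> 'e \<Rightarrow> (real^'d^'v) set" where
  "edge_space ends e = {edge_vec u v \<alpha> | u v \<alpha>. ends e = {u, v} \<and> u \<noteq> v}"

lemma edge_vec_eq_axis: "u \<noteq> v \<Longrightarrow> edge_vec u v \<alpha> = axis u \<alpha> - axis v \<alpha>"
  by (auto simp: edge_vec_def axis_def vec_eq_iff)

lemma linear_axis: "linear (axis v :: real^'d \<Rightarrow> real^'d^'v::finite)"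
  by (rule linearI) (auto simp: axis_def vec_eq_iff)

lemma linear_axis_diff: "linear (\<lambda>\<alpha>. axis u \<alpha> - axis v \<alpha> :: real^'d^'v::finite)"
  using linear_axis linear_axis by (rule linear_compose_sub)

text \<open>Swapping the endpoints amounts to negating \<open>\<alpha>\<close>, so one orientation
  yields the whole space as the range of a linear map.\<close>

lemma edge_space_eq_range:
  assumes "ends e = {u, v}" "u \<noteq> v"
  shows "edge_space ends e = range (\<lambda>\<alpha>. axis u \<alpha> - axis v \<alpha> :: real^'d^'v::finite)"
proof
  show "edge_space ends e \<subseteq> range (\<lambda>\<alpha>. axis u \<alpha> - axis v \<alpha> :: real^'d^'v)"
  proof
    fix x :: "real^'d^'v" assume "x \<in> edge_space ends e"
    then obtain u' v' \<alpha> where x: "x = axis u' \<alpha> - axis v' \<alpha>" "ends e = {u', v'}"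
      by (auto simp: edge_space_def edge_vec_eq_axis)
    then consider "u' = u" "v' = v" | "u' = v" "v' = u"
      using assms by (auto simp: doubleton_eq_iff)
    then show "x \<in> range (\<lambda>\<alpha>. axis u \<alpha> - axis v \<alpha>)"
    proof cases
      case 1
      then show ?thesis using x(1) by blast
    next
      case 2
      moreover have "axis w (- \<alpha>) = - axis w \<alpha>" for w :: 'v
        by (rule linear_neg[OF linear_axis])
      ultimately have "x = axis u (- \<alpha>) - axis v (- \<alpha>)"
        using x(1) by simp
      then show ?thesis by blast
    qed
  qed
  show "range (\<lambda>\<alpha>. axis u \<alpha> - axis v \<alpha> :: real^'d^'v) \<subseteq> edge_space ends e"
    using assms by (auto simp: edge_space_def edge_vec_eq_axis[symmetric])
qed

lemma edge_space_range:
  assumes "card (ends e) = 2"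
  obtains u v where "ends e = {u, v}" "u \<noteq> v"
    "edge_space ends e = range (\<lambda>\<alpha>. axis u \<alpha> - axis v \<alpha> :: real^'d^'v::finite)"
proof -
  obtain u v where uv: "ends e = {u, v}" "u \<noteq> v"
    using assms by (auto simp: card_2_iff)
  show thesis
    using uv edge_space_eq_range[of ends e u v, OF uv] by (rule that)
qed

lemma subspace_edge_space:
  assumes "card (ends e) = 2"
  shows "subspace (edge_space ends e :: (real^'d^'v::finite) set)"
proof -
  obtain u v where "edge_space ends e = range (\<lambda>\<alpha>. axis u \<alpha> - axis v \<alpha> :: real^'d^'v)"
    using assms by (rule edge_space_range)
  then show ?thesis
    using linear_subspace_image[OF linear_axis_diff subspace_UNIV] by simp
qed

lemma edge_space_nontrivial:
  assumes "card (ends e) = 2"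
  shows "\<exists>a\<in>edge_space ends e. (a :: real^'d^'v::finite) \<noteq> 0"
proof -
  obtain u v where uv: "u \<noteq> v"
    "edge_space ends e = range (\<lambda>\<alpha>. axis u \<alpha> - axis v \<alpha> :: real^'d^'v)"
    using assms by (rule edge_space_range)
  have "(axis u 1 - axis v 1 :: real^'d^'v) $ u \<noteq> 0"
    using uv(1) by (simp add: axis_def)
  then have "(axis u 1 - axis v 1 :: real^'d^'v) \<noteq> 0"
    by (metis zero_index)
  then show ?thesis
    using uv(2) by blast
qed

section \<open>From projective flats to linear slices\<close>

text \<open>A subspace whose flat contains the line of \<open>x\<close> contains \<open>x\<close>,
  so the smallest flat through these lines is that of \<open>span X\<close>.\<close>

lemma flat_rank_proj_span_lines: "flat_rank (proj_span {span {x} | x. x \<in> X \<and> x \<noteq> 0}) = dim X"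
proof -
  let ?L = "{span {x} | x. x \<in> X \<and> x \<noteq> 0}"
  have "?L \<subseteq> proj_flat (span X)"
    by (auto simp: proj_flat_def intro: span_base)
  then have "proj_span ?L \<subseteq> proj_flat (span X)"
    unfolding proj_span_def by blast
  moreover have "proj_flat (span X) \<subseteq> proj_flat W" if W: "subspace W" "?L \<subseteq> proj_flat W" for W
  proof -
    have "x \<in> W" if x: "x \<in> X" for x
    proof (cases "x = 0")
      case True
      then show ?thesis using W(1) by (simp add: subspace_0)
    next
      case False
      then have "span {x} \<in> proj_flat W"
        using W(2) x by blast
      then obtain y where "span {x} = span {y}" "y \<in> W"
        by (auto simp: proj_flat_def)
      then show ?thesis
        using span_base[of x "{x}"] span_minimal[of "{y}" W] W(1) by auto
    qed
    then have "span X \<subseteq> W"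
      using W(1) by (intro span_minimal) auto
    then show ?thesis
      unfolding proj_flat_def by blast
  qed
  then have "proj_flat (span X) \<subseteq> proj_span ?L"
    unfolding proj_span_def by blast
  ultimately have "proj_span ?L = proj_flat (span X)"
    by blast
  \<comment> \<open>If \<open>span X\<close> is trivial its flat is empty, and the 0 inserted by
    \<open>flat_subspace\<close> supplies its only vector.\<close>
  moreover have "flat_subspace (proj_flat (span X)) = span X"
  proof
    show "flat_subspace (proj_flat (span X)) \<subseteq> span X"
      using span_minimal[of "{_}" "span X"] by (auto simp: flat_subspace_def proj_flat_def span_0)
    show "span X \<subseteq> flat_subspace (proj_flat (span X))"
      using span_base[of _ "{_}"] by (fastforce simp: flat_subspace_def proj_flat_def)
  qed
  ultimately show ?thesis
    by (simp add: flat_rank_def)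
qed

text \<open>Computed block by block, \<open>edge_vec u v \<alpha> \<bullet> p\<close> is
  \<open>(p $ u - p $ v) \<bullet> \<alpha>\<close>, so the condition on \<open>\<alpha>\<close>
  says that the block vector lies in the hyperplane orthogonal to \<open>p\<close>.\<close>

lemma PM_rank_eq_dim_slices:
  "PM_rank ends p F = dim (\<Union>e\<in>F. slice p (edge_space ends e))"
proof -
  have inner: "edge_vec u v \<alpha> \<bullet> p = (p $ u - p $ v) \<bullet> \<alpha>" if "u \<noteq> v" for u v \<alpha>
    using that by (simp add: edge_vec_eq_axis inner_diff_left inner_axis' inner_commute[of \<alpha>])
  have zero: "edge_vec u v \<alpha> = 0 \<longleftrightarrow> \<alpha> = 0" if "u \<noteq> v" for u v :: 'b and \<alpha> :: "real^'c"
    using that by (auto simp: edge_vec_def vec_eq_iff)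
  have "\<Union>(edge_flats ends p F) =
      {span {x} | x. x \<in> (\<Union>e\<in>F. slice p (edge_space ends e)) \<and> x \<noteq> 0}" (is "?L = ?R")
  proof
    show "?L \<subseteq> ?R"
    proof
      fix l assume "l \<in> ?L"
      then obtain e u v \<alpha> where *: "e \<in> F" "l = span {edge_vec u v \<alpha>}" "ends e = {u, v}" "u \<noteq> v"
        "\<alpha> \<noteq> 0" "(p $ u - p $ v) \<bullet> \<alpha> = 0"
        by (auto simp: edge_flats_def edge_flat_def)
      then have "edge_vec u v \<alpha> \<in> slice p (edge_space ends e)" "edge_vec u v \<alpha> \<noteq> 0"
        by (auto simp: slice_def edge_space_def inner zero)
      then show "l \<in> ?R"
        using * by blast
    qed
    show "?R \<subseteq> ?L"
    proof
      fix l assume "l \<in> ?R"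
      then obtain e u v \<alpha> where *: "e \<in> F" "l = span {edge_vec u v \<alpha>}" "ends e = {u, v}" "u \<noteq> v"
        "edge_vec u v \<alpha> \<noteq> 0" "edge_vec u v \<alpha> \<bullet> p = 0"
        by (auto simp: slice_def edge_space_def)
      then have "l \<in> edge_flat ends p e"
        unfolding edge_flat_def by (auto simp: inner zero)
      then show "l \<in> ?L"
        using *(1) by (auto simp: edge_flats_def)
    qed
  qed
  then show ?thesis
    by (simp only: PM_rank_def flat_rank_proj_span_lines)
qed

section \<open>Dimensions of edge spaces and the count function\<close>

lemma dim_UN_range_le:
  fixes f :: "'i \<Rightarrow> real^'d \<Rightarrow> 'a::euclidean_space"
  assumes "finite I" "\<And>i. i \<in> I \<Longrightarrow> linear (f i)"
  shows "dim (\<Union>i\<in>I. range (f i)) \<le> card I * CARD('d)"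
proof -
  have "dim (\<Union>i\<in>I. range (f i)) \<le> (\<Sum>i\<in>I. dim (range (f i)))"
    using assms(1) by (rule dim_UN_le)
  also have "\<dots> \<le> (\<Sum>i\<in>I. CARD('d))"
  proof (rule sum_mono)
    fix i assume "i \<in> I"
    then show "dim (range (f i)) \<le> CARD('d)"
      using dim_image_le[OF assms(2), of i UNIV] by simp
  qed
  finally show ?thesis by simp
qed

text \<open>With a base vertex \<open>r\<close> fixed, the vectors with \<open>\<alpha>\<close> at
  \<open>v\<close> and \<open>- \<alpha>\<close> at \<open>r\<close>, for the other vertices
  \<open>v\<close>, generate all the edge spaces. The bound is strict when \<open>X\<close> is
  disconnected.\<close>

lemma dim_edge_spaces_le:
  fixes ends :: "'e \<Rightarrow> 'v::finite set"
  assumes two: "\<And>e. e \<in> X \<Longrightarrow> card (ends e) = 2" and "X \<noteq> {}"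
  shows "int (dim (\<Union>e\<in>X. edge_space ends e :: (real^'d^'v) set)) - 1 \<le> count_fun CARD('d) ends X"
proof -
  obtain r where r: "r \<in> edge_verts ends X"
  proof -
    obtain e where e: "e \<in> X"
      using \<open>X \<noteq> {}\<close> by blast
    then have "ends e \<noteq> {}"
      using two by force
    then show ?thesis
      using e that by (auto simp: edge_verts_def)
  qed
  let ?f = "\<lambda>v \<alpha>. axis v \<alpha> - axis r \<alpha> :: real^'d^'v"
  let ?B = "\<Union>v\<in>edge_verts ends X - {r}. range (?f v)"
  have f: "?f v \<alpha> \<in> span ?B" if "v \<in> edge_verts ends X" for v \<alpha>
    using that by (cases "v = r") (auto simp: span_0 intro: span_base)
  have "(\<Union>e\<in>X. edge_space ends e :: (real^'d^'v) set) \<subseteq> span ?B"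
  proof clarify
    fix e and x :: "real^'d^'v" assume e: "e \<in> X" "x \<in> edge_space ends e"
    obtain u v where uv: "ends e = {u, v}"
      "edge_space ends e = range (\<lambda>\<alpha>. axis u \<alpha> - axis v \<alpha> :: real^'d^'v)"
      using two[OF e(1)] by (rule edge_space_range)
    then obtain \<alpha> where "x = ?f u \<alpha> - ?f v \<alpha>"
      using e(2) by auto
    moreover have "u \<in> edge_verts ends X" "v \<in> edge_verts ends X"
      using e(1) uv(1) by (auto simp: edge_verts_def)
    ultimately show "x \<in> span ?B"
      using f by (simp only: span_diff)
  qed
  then have "dim (\<Union>e\<in>X. edge_space ends e :: (real^'d^'v) set) \<le> dim (span ?B)"
    by (rule dim_subset)
  also have "\<dots> = dim ?B"
    by (rule dim_span)
  also have "\<dots> \<le> card (edge_verts ends X - {r}) * CARD('d)"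
    by (rule dim_UN_range_le) (simp, rule linear_axis_diff)
  finally have "int (dim (\<Union>e\<in>X. edge_space ends e :: (real^'d^'v) set)) \<le>
      int (card (edge_verts ends X - {r})) * int CARD('d)"
    by (metis of_nat_le_iff of_nat_mult)
  moreover have "int (card (edge_verts ends X - {r})) = int (card (edge_verts ends X)) - 1"
    using card_Suc_Diff1[OF finite[of "edge_verts ends X"] r] by linarith
  ultimately show ?thesis
    by (simp add: count_fun_def algebra_simps)
qed

text \<open>The parts are the connected components, with connectivity of \<open>v\<close> and \<open>v'\<close> expressed
  by the space of all \<open>\<alpha>\<close> at \<open>v\<close>, \<open>- \<alpha>\<close> at \<open>v'\<close> lying in the span of the edge spaces.\<close>

lemma exists_component_partition:
  fixes ends :: "'e \<Rightarrow> 'v::finite set"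
  assumes two: "\<And>e. e \<in> X \<Longrightarrow> card (ends e) = 2" and "X \<noteq> {}"
  shows "\<exists>Q. partition_on X Q \<and> (\<Sum>Y\<in>Q. count_fun CARD('d) ends Y) \<le>
    int (dim (\<Union>e\<in>X. edge_space ends e :: (real^'d^'v) set)) - 1"
proof -
  define S where "S = span (\<Union>e\<in>X. edge_space ends e :: (real^'d^'v) set)"
  define V where "V = edge_verts ends X"
  define conn where "conn v v' \<longleftrightarrow> (\<forall>\<alpha>. axis v \<alpha> - axis v' \<alpha> \<in> S)" for v v'
  define root where "root v = (SOME v'. conn v v')" for v
  have refl: "conn v v" for v
    by (simp add: conn_def S_def span_0)
  have sym: "conn v' v" if "conn v v'" for v v'
    unfolding conn_def
  proof
    fix \<alpha>
    show "axis v' \<alpha> - axis v \<alpha> \<in> S"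
      using that span_neg[of "axis v \<alpha> - axis v' \<alpha>"] unfolding conn_def S_def by fastforce
  qed
  have trans: "conn u w" if "conn u v" "conn v w" for u v w
    unfolding conn_def
  proof
    fix \<alpha>
    have "(axis u \<alpha> - axis v \<alpha>) + (axis v \<alpha> - axis w \<alpha>) \<in> S"
      using that unfolding conn_def S_def by (intro span_add) blast+
    then show "axis u \<alpha> - axis w \<alpha> \<in> S"
      by simp
  qed
  have conn_root: "conn v (root v)" for v
    unfolding root_def using refl by (rule someI)
  \<comment> \<open>Connected vertices have the same predicate \<open>conn\<close>, so the choice
    operator returns the same representative.\<close>
  have root_eq: "root u = root v" if "conn u v" for u v
  proof -
    have "conn u = conn v"
      using that sym trans by blast
    then show ?thesis
      by (simp add: root_def)
  qed
  have root_ends: "root u = root v" if e: "e \<in> X" and uv: "u \<in> ends e" "v \<in> ends e" for e u v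
  proof -
    obtain x y where xy: "ends e = {x, y}"
      "edge_space ends e = range (\<lambda>\<alpha>. axis x \<alpha> - axis y \<alpha> :: real^'d^'v)"
      using two[OF e] by (rule edge_space_range)
    have "conn x y"
      unfolding conn_def
    proof
      fix \<alpha> :: "real^'d"
      have "(axis x \<alpha> - axis y \<alpha> :: real^'d^'v) \<in> edge_space ends e"
        unfolding xy(2) by (rule rangeI)
      then show "axis x \<alpha> - axis y \<alpha> \<in> S"
        using e unfolding S_def by (blast intro: span_base)
    qed
    then have "root x = root y"
      by (rule root_eq)
    then show ?thesis
      using uv xy(1) by auto
  qed
  define Y where "Y t = {e \<in> X. \<exists>v\<in>ends e. root v = t}" for t
  define R where "R = root ` V"
  have ends_ne: "ends e \<noteq> {}" if "e \<in> X" for e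
    using two[OF that] by auto
  have verts_Y: "edge_verts ends (Y t) = {v \<in> V. root v = t}" for t
  proof (rule set_eqI)
    fix v
    have "v \<in> edge_verts ends (Y t) \<longleftrightarrow> (\<exists>e\<in>X. v \<in> ends e \<and> (\<exists>w\<in>ends e. root w = t))"
      by (auto simp: edge_verts_def Y_def)
    also have "\<dots> \<longleftrightarrow> (\<exists>e\<in>X. v \<in> ends e \<and> root v = t)"
      using root_ends by metis
    also have "\<dots> \<longleftrightarrow> v \<in> {v \<in> V. root v = t}"
      by (auto simp: edge_verts_def V_def)
    finally show "v \<in> edge_verts ends (Y t) \<longleftrightarrow> v \<in> {v \<in> V. root v = t}" .
  qed
  have Y_ne: "Y t \<noteq> {}" if "t \<in> R" for t
    using that by (auto simp: R_def V_def Y_def edge_verts_def)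
  have disj: "t = t'" if "e \<in> Y t" "e \<in> Y t'" for e t t'
    using that root_ends unfolding Y_def by blast
  have inj: "inj_on Y R"
  proof (rule inj_onI)
    fix t t' assume "t \<in> R" "Y t = Y t'"
    then show "t = t'"
      using Y_ne[of t] disj by blast
  qed
  have "partition_on X (Y ` R)"
  proof (rule partition_onI)
    have "e \<in> \<Union>(Y ` R)" if e: "e \<in> X" for e
    proof -
      obtain v where "v \<in> ends e"
        using ends_ne[OF e] by blast
      then have "e \<in> Y (root v)" "root v \<in> R"
        using e by (auto simp: Y_def R_def V_def edge_verts_def)
      then show ?thesis by blast
    qed
    then show "\<Union>(Y ` R) = X"
      by (auto simp: Y_def)
    show "disjnt A B" if "A \<in> Y ` R" "B \<in> Y ` R" "A \<noteq> B" for A B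
      using that disj unfolding disjnt_def by blast
    show "{} \<notin> Y ` R"
      using Y_ne by blast
  qed
  moreover have "(\<Sum>A\<in>Y ` R. count_fun CARD('d) ends A) \<le> int (dim S) - 1"
  proof -
    have card_V: "card V = (\<Sum>t\<in>R. card {v \<in> V. root v = t})"
      using sum.image_gen[of V "\<lambda>_. 1 :: nat" root] by (simp add: R_def)
    have "(\<Sum>A\<in>Y ` R. count_fun CARD('d) ends A) = (\<Sum>t\<in>R. count_fun CARD('d) ends (Y t))"
      using inj by (simp add: sum.reindex)
    also have "\<dots> = int CARD('d) * int (card V) - (int CARD('d) + 1) * int (card R)"
      by (simp add: count_fun_def verts_Y card_V sum_subtractf sum_distrib_left)
    finally have sum: "(\<Sum>A\<in>Y ` R. count_fun CARD('d) ends A) =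
        int CARD('d) * int (card V) - (int CARD('d) + 1) * int (card R)" .
    \<comment> \<open>Adding to \<open>S\<close> a full block at each root and at each vertex
      outside \<open>V\<close> generates the whole space. Counting dimensions bounds
      \<open>dim S\<close> below by \<open>d\<close> times \<open>card V\<close> minus
      \<open>card R\<close>.\<close>
    define B where "B = S \<union> (\<Union>t\<in>R \<union> - V. range (axis t :: real^'d \<Rightarrow> real^'d^'v))"
    have base: "axis t \<alpha> \<in> span B" if "t \<in> R \<union> - V" for t \<alpha>
      using that unfolding B_def by (blast intro: span_base)
    have axis: "axis v \<alpha> \<in> span B" for v \<alpha>
    proof (cases "v \<in> V")
      case True
      have "axis v \<alpha> - axis (root v) \<alpha> \<in> S"
        using conn_root[of v] by (simp add: conn_def)
      then have "axis v \<alpha> - axis (root v) \<alpha> \<in> span B"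
        by (simp add: B_def span_base)
      moreover have "axis (root v) \<alpha> \<in> span B"
        using True by (intro base) (simp add: R_def)
      ultimately have "(axis v \<alpha> - axis (root v) \<alpha>) + axis (root v) \<alpha> \<in> span B"
        by (rule span_add)
      then show ?thesis by simp
    qed (use base in blast)
    have "x \<in> span B" for x
    proof -
      have "(\<Sum>v\<in>UNIV. axis v (x $ v)) \<in> span B"
        using axis by (rule span_sum)
      moreover have "(\<Sum>v\<in>UNIV. axis v (x $ v)) = x"
        by (simp add: vec_eq_iff axis_def)
      ultimately show ?thesis by (simp only:)
    qed
    then have "dim (UNIV :: (real^'d^'v) set) \<le> dim (span B)"
      by (intro dim_subset) blast
    also have "\<dots> = dim B"
      by (rule dim_span)
    also have "\<dots> \<le> dim S + dim (\<Union>t\<in>R \<union> - V. range (axis t :: real^'d \<Rightarrow> real^'d^'v))"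
      unfolding B_def by (rule dim_Un_le)
    also have "\<dots> \<le> dim S + card (R \<union> - V) * CARD('d)"
      by (rule add_left_mono, rule dim_UN_range_le) (simp, rule linear_axis)
    also have "\<dots> \<le> dim S + (card R + card (- V)) * CARD('d)"
      using card_Un_le[of R "- V"] by simp
    finally have "CARD('v) * CARD('d) \<le> dim S + (card R + card (- V)) * CARD('d)"
      by simp
    then have "int CARD('v) * int CARD('d) \<le>
        int (dim S) + (int (card R) + int (card (- V))) * int CARD('d)"
      by (metis of_nat_add of_nat_le_iff of_nat_mult)
    moreover have "int (card (- V)) = int CARD('v) - int (card V)"
      by (simp add: Compl_eq_Diff_UNIV card_Diff_subset of_nat_diff card_mono)
    ultimately have "int CARD('d) * int (card V) - int CARD('d) * int (card R) \<le> int (dim S)"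
      by (simp add: algebra_simps)
    \<comment> \<open>The sum of the counts is \<open>d\<close> times \<open>card V\<close> minus
      \<open>card R\<close>, less a further \<open>card R\<close>; a single class already pays for
      the \<open>- 1\<close> on the right.\<close>
    moreover have "card R \<ge> 1"
    proof -
      have "V \<noteq> {}"
        using \<open>X \<noteq> {}\<close> ends_ne by (auto simp: V_def edge_verts_def)
      then show ?thesis
        by (simp add: R_def card_gt_0_iff Suc_le_eq)
    qed
    ultimately show ?thesis
      unfolding sum by (simp add: algebra_simps)
  qed
  ultimately show ?thesis
    by (auto simp: S_def)
qed

text \<open>The second claim, due to the members being nonempty subsets of disjoint parts, allows
  sums over the refinement to be split part by part.\<close>

lemma partition_on_UN:
  assumes "partition_on F P" "\<And>X. X \<in> P \<Longrightarrow> partition_on X (Q X)"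
  shows "partition_on F (\<Union>X\<in>P. Q X)"
    and "\<lbrakk>X \<in> P; X' \<in> P; X \<noteq> X'\<rbrakk> \<Longrightarrow> Q X \<inter> Q X' = {}"
proof -
  have sub: "A \<subseteq> X" if "X \<in> P" "A \<in> Q X" for A X
    using partition_onD1[OF assms(2)[OF that(1)]] that(2) by blast
  have nonempty: "A \<noteq> {}" if "X \<in> P" "A \<in> Q X" for A X
    using partition_onD3[OF assms(2)[OF that(1)]] that(2) by metis
  have disj: "X = X'" if "X \<in> P" "X' \<in> P" "x \<in> X" "x \<in> X'" for x X X'
    using partition_onD2[OF assms(1)] that unfolding disjoint_def by blast
  show "Q X \<inter> Q X' = {}" if "X \<in> P" "X' \<in> P" "X \<noteq> X'" for X X'
  proof -
    have "A = {}" if "A \<in> Q X" "A \<in> Q X'" for A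
      using sub[OF \<open>X \<in> P\<close> that(1)] sub[OF \<open>X' \<in> P\<close> that(2)] disj[OF \<open>X \<in> P\<close> \<open>X' \<in> P\<close>]
        \<open>X \<noteq> X'\<close> by blast
    then show ?thesis
      using nonempty[OF \<open>X \<in> P\<close>] by blast
  qed
  show "partition_on F (\<Union>X\<in>P. Q X)"
  proof (rule partition_onI)
    have "\<Union>(\<Union>X\<in>P. Q X) = (\<Union>X\<in>P. \<Union>(Q X))"
      by blast
    also have "\<dots> = (\<Union>X\<in>P. X)"
      by (rule SUP_cong[OF refl]) (rule partition_onD1[OF assms(2), symmetric])
    finally show "\<Union>(\<Union>X\<in>P. Q X) = F"
      using partition_onD1[OF assms(1)] by simp
    show "{} \<notin> (\<Union>X\<in>P. Q X)"
      using nonempty by blast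
    show "disjnt A B" if AB: "A \<in> (\<Union>X\<in>P. Q X)" "B \<in> (\<Union>X\<in>P. Q X)" "A \<noteq> B" for A B
    proof -
      obtain X X' where X: "X \<in> P" "A \<in> Q X" "X' \<in> P" "B \<in> Q X'"
        using AB by blast
      show ?thesis
      proof (cases "X = X'")
        case True
        then show ?thesis
          using partition_onD2[OF assms(2)[OF X(1)]] X AB(3)
          unfolding disjoint_def disjnt_def by blast
      next
        case False
        then show ?thesis
          using sub[OF X(1,2)] sub[OF X(3,4)] disj[OF X(1,3)] unfolding disjnt_def by blast
      qed
    qed
  qed
qed

text \<open>The two set functions differ on disconnected sets, but their minima agree: one is
  bounded by the other on nonempty sets, and conversely the parts of an optimal partition can be
  refined into components without raising the value.\<close>

lemma hat_edge_spaces_eq: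
  fixes ends :: "'e \<Rightarrow> 'v::finite set"
  assumes fin: "finite F" and two: "\<And>e. e \<in> F \<Longrightarrow> card (ends e) = 2"
  shows "hat (\<lambda>X. int (dim (\<Union>e\<in>X. edge_space ends e :: (real^'d^'v) set)) - 1) F =
    hat (count_fun CARD('d) ends) F" (is "hat ?g F = hat ?f F")
proof (rule antisym)
  obtain P where P: "partition_on F P" "hat ?f F = (\<Sum>X\<in>P. ?f X)"
    by (rule hat_attained[OF fin])
  have "hat ?g F \<le> (\<Sum>X\<in>P. ?g X)"
    using fin P(1) by (rule hat_le_sum)
  also have "\<dots> \<le> (\<Sum>X\<in>P. ?f X)"
  proof (rule sum_mono)
    fix X assume "X \<in> P"
    then have "X \<subseteq> F" "X \<noteq> {}"
      using P(1) by (auto simp: partition_on_def)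
    then show "?g X \<le> ?f X"
      using two by (intro dim_edge_spaces_le) auto
  qed
  finally show "hat ?g F \<le> hat ?f F"
    using P(2) by simp
next
  obtain P where P: "partition_on F P" "hat ?g F = (\<Sum>X\<in>P. ?g X)"
    by (rule hat_attained[OF fin])
  have sub: "X \<subseteq> F" "X \<noteq> {}" if "X \<in> P" for X
    using P(1) that by (auto simp: partition_on_def)
  have "\<forall>X\<in>P. \<exists>Q. partition_on X Q \<and> (\<Sum>Y\<in>Q. ?f Y) \<le> ?g X"
    using sub two by (intro ballI exists_component_partition) auto
  then obtain Q where Q: "\<And>X. X \<in> P \<Longrightarrow> partition_on X (Q X)"
    "\<And>X. X \<in> P \<Longrightarrow> (\<Sum>Y\<in>Q X. ?f Y) \<le> ?g X"
    by metis
  have "hat ?f F \<le> (\<Sum>Y\<in>(\<Union>X\<in>P. Q X). ?f Y)"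
    using fin partition_on_UN(1)[OF P(1) Q(1)] by (rule hat_le_sum)
  also have "\<dots> = (\<Sum>X\<in>P. \<Sum>Y\<in>Q X. ?f Y)"
  proof (rule sum.UNION_disjoint)
    show "finite P"
      using fin P(1) by (rule finite_elements)
    show "\<forall>X\<in>P. finite (Q X)"
      using finite_elements[OF finite_subset[OF sub(1) fin] Q(1)] by blast
    show "\<forall>X\<in>P. \<forall>X'\<in>P. X \<noteq> X' \<longrightarrow> Q X \<inter> Q X' = {}"
      by (intro ballI impI) (rule partition_on_UN(2)[OF P(1) Q(1)])
  qed
  also have "\<dots> \<le> (\<Sum>X\<in>P. ?g X)"
    using Q(2) by (rule sum_mono)
  finally show "hat ?f F \<le> hat ?g F"
    using P(2) by simp
qed

theorem theorem6p1:
  fixes E :: "'e set" and ends :: "'e \<Rightarrow> 'v::finite set"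
  assumes "CARD('d::finite) \<ge> 2"
    and "finite_graph E ends"
  shows "AE p in (lborel :: (real^'d^'v) measure).
           \<forall>F\<subseteq>E. int (PM_rank ends p F) = hat (count_fun CARD('d) ends) F"
proof -
  have fin: "finite E" and two: "\<And>e. e \<in> E \<Longrightarrow> card (ends e) = 2"
    using assms(2) by (auto simp: finite_graph_def)
  \<comment> \<open>The joint-configuration, read as a vector of the block space, is itself the
    generic normal vector of the hyperplane.\<close>
  have "AE p in (lborel :: (real^'d^'v) measure). \<forall>F\<subseteq>E.
      int (dim (\<Union>e\<in>F. slice p (edge_space ends e))) =
      hat (\<lambda>X. int (dim (\<Union>e\<in>X. edge_space ends e :: (real^'d^'v) set)) - 1) F"
    by (rule Lovasz_generic_hyperplane[OF fin])
      (simp_all add: two subspace_edge_space edge_space_nontrivial)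
  then show ?thesis
  proof eventually_elim
    fix p :: "real^'d^'v"
    assume *: "\<forall>F\<subseteq>E. int (dim (\<Union>e\<in>F. slice p (edge_space ends e))) =
      hat (\<lambda>X. int (dim (\<Union>e\<in>X. edge_space ends e :: (real^'d^'v) set)) - 1) F"
    show "\<forall>F\<subseteq>E. int (PM_rank ends p F) = hat (count_fun CARD('d) ends) F"
    proof (intro allI impI)
      fix F assume F: "F \<subseteq> E"
      then have "hat (\<lambda>X. int (dim (\<Union>e\<in>X. edge_space ends e :: (real^'d^'v) set)) - 1) F =
          hat (count_fun CARD('d) ends) F"
        using two finite_subset[OF F fin] by (intro hat_edge_spaces_eq) auto
      then show "int (PM_rank ends p F) = hat (count_fun CARD('d) ends) F"
        using * F by (simp add: PM_rank_eq_dim_slices)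
    qed
  qed
qed

end
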